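(* Let $\mathcal{H}$ be a complex Hilbert space, let $T_1,\ldots,T_n\in\mathbb{B}(\mathcal{H})$, and let $f:[0,\infty)\to[0,\infty)$ be a strictly increasing operator convex function such that $f(0)=0$. If $0\le\alpha\le1$ and $0\le\lambda\le 1$, then $$\begin{aligned} \omega_f(T_1,\ldots,T_n) &\le f^{-1}\left(\left\|\sum_{j=1}^n\left[(1-\lambda)f\left(\frac{(1-\lambda)|T_j|^{2\alpha}+(1+\lambda)|T_j^*|^{2(1-\alpha)}}{2}\right)+\lambda f\left(\frac{(2-\lambda)|T_j|^{2\alpha}+\lambda|T_j^*|^{2(1-\alpha)}}{2}\right)\right]\right\|\right)\\ &\le f^{-1}\left(\left\|\int_0^1\sum_{j=1}^n f\left(t|T_j|^{2\alpha}+(1-t)|T_j^*|^{2(1-\alpha)}\right)dt\right\|\right)\\ &\le f^{-1}\left(\frac12\left\|\sum_{j=1}^n\left(f\left(|T_j|^{2\alpha}\right)+f\left(|T_j^*|^{2(1-\alpha)}\right)\right)\right\|\right). \end{aligned}$$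
   Context: $\mathbb{B}(\mathcal{H})$ is the $C^*$-algebra of all bounded linear operators on $\mathcal{H}$, and $\|\cdot\|$ is the operator norm. $|T|=(T^*T)^{1/2}$, and for a positive operator $A$ the operators $A^s$ ($s\ge0$, with $A^0=I$ the identity) and $f(A)$ are given by the continuous functional calculus. A function $f:[0,\infty)\to\mathbb{R}$ is operator convex if $f((1-t)A+tB)\le(1-t)f(A)+tf(B)$ (in the order of self-adjoint operators) for all positive operators $A,B$ and all $t\in[0,1]$. For a strictly increasing convex function $f$ with $f(0)=0$, the $f$-operator radius is $$\omega_f(T_1,\ldots,T_n)=\sup_{\|x\|=1}f^{-1}\left(\sum_{i=1}^n f\left(|\langle T_ix,x\rangle|\right)\right).$$ *)

theory Defs
  imports "HOL-Analysis.Analysis" "HOL-Computational_Algebra.Polynomial"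
begin

text \<open>Complex Hilbert spaces. The inner product is linear in its first argument.\<close>

class chilbert_space = banach +
  fixes scaleC :: "complex \<Rightarrow> 'a \<Rightarrow> 'a"  (infixr \<open>*\<^sub>C\<close> 75)
    and cinner :: "'a \<Rightarrow> 'a \<Rightarrow> complex"
  assumes scaleC_add_right: "a *\<^sub>C (x + y) = a *\<^sub>C x + a *\<^sub>C y"
    and scaleC_add_left: "(a + b) *\<^sub>C x = a *\<^sub>C x + b *\<^sub>C x"
    and scaleC_scaleC: "a *\<^sub>C (b *\<^sub>C x) = (a * b) *\<^sub>C x"
    and scaleR_scaleC: "r *\<^sub>R x = complex_of_real r *\<^sub>C x"
    and cinner_commute: "cinner x y = cnj (cinner y x)"
    and cinner_add_left: "cinner (x + y) z = cinner x z + cinner y z"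
    and cinner_scaleC_left: "cinner (a *\<^sub>C x) y = a * cinner x y"
    and cinner_ge_zero: "0 \<le> Re (cinner x x)"
    and cinner_eq_zero_iff: "cinner x x = 0 \<longleftrightarrow> x = 0"
    and norm_eq_sqrt_cinner: "norm x = sqrt (Re (cinner x x))"

instantiation complex :: chilbert_space
begin

definition scaleC_complex :: "complex \<Rightarrow> complex \<Rightarrow> complex"
  where "scaleC_complex a x = a * x"

definition cinner_complex :: "complex \<Rightarrow> complex \<Rightarrow> complex"
  where "cinner_complex x y = x * cnj y"

instance
  by standard
    (auto simp: scaleC_complex_def cinner_complex_def algebra_simps scaleR_conv_of_real
      cmod_def power2_eq_square)

end

text \<open>
  The library type of bounded \<^emph>\<open>real\<close>-linear operators carries the operator norm and is a
  Banach space; the algebra of bounded complex-linear operators is the following subset of it.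
\<close>

definition bounded_ops :: "('a::chilbert_space \<Rightarrow>\<^sub>L 'a) set"
  where "bounded_ops = {T. \<forall>c x. blinfun_apply T (c *\<^sub>C x) = c *\<^sub>C blinfun_apply T x}"

definition adj :: "('a::chilbert_space \<Rightarrow>\<^sub>L 'a) \<Rightarrow> 'a \<Rightarrow>\<^sub>L 'a"
  where "adj T = (THE S. S \<in> bounded_ops \<and>
    (\<forall>x y. cinner (blinfun_apply T x) y = cinner x (blinfun_apply S y)))"

definition positive_op :: "('a::chilbert_space \<Rightarrow>\<^sub>L 'a) \<Rightarrow> bool"
  where "positive_op A \<longleftrightarrow> A \<in> bounded_ops \<and>
    (\<forall>x. cinner (blinfun_apply A x) x \<in> \<real> \<and> 0 \<le> Re (cinner (blinfun_apply A x) x))"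

definition op_le :: "('a::chilbert_space \<Rightarrow>\<^sub>L 'a) \<Rightarrow> ('a \<Rightarrow>\<^sub>L 'a) \<Rightarrow> bool"
  where "op_le A B \<longleftrightarrow> positive_op (B - A)"

definition spectrum :: "('a::chilbert_space \<Rightarrow>\<^sub>L 'a) \<Rightarrow> complex set"
  where "spectrum A = {z. \<not> (\<exists>S\<in>bounded_ops. \<forall>x.
    blinfun_apply S (blinfun_apply A x - z *\<^sub>C x) = x \<and>
    blinfun_apply A (blinfun_apply S x) - z *\<^sub>C blinfun_apply S x = x)}"

definition poly_op :: "real poly \<Rightarrow> ('a::real_normed_vector \<Rightarrow>\<^sub>L 'a) \<Rightarrow> 'a \<Rightarrow>\<^sub>L 'a"
  where "poly_op p A = (\<Sum>i\<le>degree p. coeff p i *\<^sub>R (((o\<^sub>L) A ^^ i) id_blinfun))"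

text \<open>
  Continuous functional calculus of a self-adjoint operator \<open>A\<close> (whose spectrum is real) at a
  real function \<open>f\<close> continuous on the spectrum: the norm limit of \<open>p\<^sub>k(A)\<close> for polynomials
  \<open>p\<^sub>k\<close> that converge to \<open>f\<close> uniformly on the spectrum. Only the values of \<open>f\<close> on the
  spectrum matter.
\<close>

definition cfc :: "(real \<Rightarrow> real) \<Rightarrow> ('a::chilbert_space \<Rightarrow>\<^sub>L 'a) \<Rightarrow> 'a \<Rightarrow>\<^sub>L 'a"
  where "cfc f A = (THE B. \<exists>p :: nat \<Rightarrow> real poly.
    uniform_limit {r. complex_of_real r \<in> spectrum A} (\<lambda>k. poly (p k)) f sequentially \<and>
    (\<lambda>k. poly_op (p k) A) \<longlonglongrightarrow> B)"

text \<open>The case distinction enforces \<open>A\<^sup>0 = I\<close>, since \<open>0 powr 0 = 0\<close> in HOL.\<close>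

definition op_powr :: "('a::chilbert_space \<Rightarrow>\<^sub>L 'a) \<Rightarrow> real \<Rightarrow> 'a \<Rightarrow>\<^sub>L 'a"
  where "op_powr A s = cfc (\<lambda>r. if s = 0 then 1 else r powr s) A"

definition op_abs :: "('a::chilbert_space \<Rightarrow>\<^sub>L 'a) \<Rightarrow> 'a \<Rightarrow>\<^sub>L 'a"
  where "op_abs T = op_powr (adj T o\<^sub>L T) (1/2)"

text \<open>
  Functions on \<open>[0,\<infinity>)\<close> are represented by functions on the reals whose values at negative
  arguments are irrelevant. Operator convexity refers to the positive operators on the
  Hilbert space under consideration.
\<close>

definition operator_convex :: "'a::chilbert_space itself \<Rightarrow> (real \<Rightarrow> real) \<Rightarrow> bool"
  where "operator_convex _ f \<longleftrightarrow> (\<forall>(A :: 'a \<Rightarrow>\<^sub>L 'a) B. \<forall>t\<in>{0..1}.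
    positive_op A \<longrightarrow> positive_op B \<longrightarrow>
    op_le (cfc f ((1 - t) *\<^sub>R A + t *\<^sub>R B)) ((1 - t) *\<^sub>R cfc f A + t *\<^sub>R cfc f B))"

abbreviation finv :: "(real \<Rightarrow> real) \<Rightarrow> real \<Rightarrow> real"
  where "finv f \<equiv> inv_into {0..} f"

text \<open>
  The supremum is taken in \<open>[0,\<infinity>)\<close>. Inserting \<open>0\<close> has no effect unless the space is zero,
  where there is no unit vector and the supremum is \<open>0\<close>.
\<close>

definition omega :: "(real \<Rightarrow> real) \<Rightarrow> nat \<Rightarrow> (nat \<Rightarrow> 'a::chilbert_space \<Rightarrow>\<^sub>L 'a) \<Rightarrow> real"
  where "omega f n T = Sup (insert 0
    {finv f (\<Sum>i=1..n. f (cmod (cinner (blinfun_apply (T i) x) x))) | x. norm x = 1})"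

end

theory Submission
  imports Defs "HOL-Computational_Algebra.Fundamental_Theorem_Algebra"
begin

text \<open>
  Write \<open>A\<^sub>j = |T\<^sub>j|\<^sup>2\<^sup>\<alpha>\<close>, \<open>B\<^sub>j = |T\<^sub>j\<^sup>*|\<^sup>2\<^sup>(\<^sup>1\<^sup>-\<^sup>\<alpha>\<^sup>)\<close> and \<open>g(t) = \<Sum>\<^sub>j f(t A\<^sub>j + (1 - t) B\<^sub>j)\<close>. The three upper bounds are
  \<open>f\<inverse>\<close> of the norms of \<open>(1 - \<lambda>) g((1 - \<lambda>)/2) + \<lambda> g((2 - \<lambda>)/2)\<close>, of \<open>\<integral>\<^sub>0\<^sup>1 g\<close> and of \<open>(g(0) + g(1))/2\<close>.

  Operator convexity of \<open>f\<close> makes \<open>\<phi>(t) = \<langle>g(t)x, x\<rangle>\<close> a convex function of \<open>t\<close> for every vector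
  \<open>x\<close>. The Hermite-Hadamard inequalities (\<open>Hermite_Hadamard\<close>) for \<open>\<phi>\<close>, the lower one on each of
  \<open>[0, 1 - \<lambda>]\<close> and \<open>[1 - \<lambda>, 1]\<close>, whose midpoints are the two evaluation points, and the upper one
  on \<open>[0, 1]\<close>, order the quadratic forms of the three positive operators, hence their norms
  (\<open>norm_mono_psd\<close>). The function \<open>f\<inverse>\<close> preserves this order: restricted to scalar operators,
  operator convexity says that \<open>f\<close> is convex, so on a nonzero space it is a continuous bijection of \<open>[0, \<infinity>)\<close>.

  The radius is bounded for each unit vector separately. The mixed Schwarz inequality
  (\<open>mixed_Schwarz\<close>) and the inequality of the means give
  \<open>|\<langle>T\<^sub>jx, x\<rangle>| \<le> (\<langle>A\<^sub>jx, x\<rangle> + \<langle>B\<^sub>jx, x\<rangle>)/2\<close>. The right-hand side is the convex combination, with weights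
  \<open>1 - \<lambda>\<close> and \<open>\<lambda>\<close>, of the values at \<open>x\<close> of the forms of \<open>t A\<^sub>j + (1 - t) B\<^sub>j\<close> at the two evaluation
  points, so convexity of \<open>f\<close> and Jensen's inequality \<open>f(\<langle>Ax, x\<rangle>) \<le> \<langle>f(A)x, x\<rangle>\<close> (\<open>cfc_Jensen\<close>)
  finish the argument.

  This rests on some operator theory. Minimisation of a coercive quadratic form
  (\<open>coercive_representation\<close>) yields adjoints and confines the spectrum of
  a positive operator \<open>A\<close> to \<open>[0, \<parallel>A\<parallel>]\<close>. Factoring polynomials shows that \<open>\<parallel>p(A)\<parallel>\<close> is at most the
  supremum of \<open>|p|\<close> on the real spectrum (\<open>norm_poly_op_le\<close>), which makes the functional calculus
  well defined and, with the Weierstrass theorem, defined for every continuous function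
  (\<open>cfc_limit\<close>). It is a homomorphism that preserves positivity, respects intertwining and
  depends continuously on \<open>A\<close>; in particular \<open>g\<close> is integrable.
\<close>

section \<open>Inner products and hermitian operators\<close>

lemma cinner_add_right: "cinner x (y + z) = cinner x y + cinner x z"
  for x y z :: "'a::chilbert_space"
  using cinner_commute[of x "y + z"] cinner_commute[of x y] cinner_commute[of x z]
  by (simp add: cinner_add_left)

lemma cinner_scaleC_right: "cinner x (a *\<^sub>C y) = cnj a * cinner x y"
  for x y :: "'a::chilbert_space"
  using cinner_commute[of x "a *\<^sub>C y"] cinner_commute[of x y]
  by (simp add: cinner_scaleC_left)

lemma cinner_scaleR_left: "cinner (r *\<^sub>R x) y = of_real r * cinner x y"
  for x y :: "'a::chilbert_space"
  by (simp add: scaleR_scaleC cinner_scaleC_left)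

lemma cinner_scaleR_right: "cinner x (r *\<^sub>R y) = of_real r * cinner x y"
  for x y :: "'a::chilbert_space"
  by (simp add: scaleR_scaleC cinner_scaleC_right)

lemma cinner_zero_left [simp]: "cinner 0 x = 0" for x :: "'a::chilbert_space"
  using cinner_add_left[of 0 0 x] by simp

lemma cinner_zero_right [simp]: "cinner x 0 = 0" for x :: "'a::chilbert_space"
  using cinner_add_right[of x 0 0] by simp

lemma cinner_minus_left: "cinner (- x) y = - cinner x y" for x y :: "'a::chilbert_space"
  using cinner_scaleR_left[of "-1" x y] by simp

lemma cinner_minus_right: "cinner x (- y) = - cinner x y" for x y :: "'a::chilbert_space"
  using cinner_scaleR_right[of x "-1" y] by simp

lemma cinner_diff_left: "cinner (x - y) z = cinner x z - cinner y z"
  for x y z :: "'a::chilbert_space"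
  using cinner_add_left[of x "-y" z] by (simp add: cinner_minus_left)

lemma cinner_diff_right: "cinner x (y - z) = cinner x y - cinner x z"
  for x y z :: "'a::chilbert_space"
  using cinner_add_right[of x y "-z"] by (simp add: cinner_minus_right)

lemmas cinner_simps = cinner_add_left cinner_add_right cinner_diff_left cinner_diff_right
  cinner_minus_left cinner_minus_right cinner_scaleR_left cinner_scaleR_right
  cinner_scaleC_left cinner_scaleC_right

lemma Re_cinner_self: "Re (cinner x x) = (norm x)\<^sup>2" for x :: "'a::chilbert_space"
  by (simp add: norm_eq_sqrt_cinner cinner_ge_zero)

lemma Re_cinner_commute: "Re (cinner x y) = Re (cinner y x)" for x y :: "'a::chilbert_space"
  using arg_cong[OF cinner_commute[of x y], of Re] by simp

lemma cinner_self: "cinner x x = of_real ((norm x)\<^sup>2)" for x :: "'a::chilbert_space"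
  using arg_cong[OF cinner_commute[of x x], of Im] by (simp add: complex_eq_iff Re_cinner_self)

lemma norm_scaleC: "norm (a *\<^sub>C x) = cmod a * norm x" for x :: "'a::chilbert_space"
proof -
  have "cinner (a *\<^sub>C x) (a *\<^sub>C x) = a * cnj a * cinner x x"
    by (simp add: cinner_simps)
  then have "of_real ((norm (a *\<^sub>C x))\<^sup>2) = (of_real ((cmod a * norm x)\<^sup>2) :: complex)"
    unfolding cinner_self complex_norm_square[of a, symmetric] by (simp add: power_mult_distrib)
  then have "(norm (a *\<^sub>C x))\<^sup>2 = (cmod a * norm x)\<^sup>2"
    by (simp only: of_real_eq_iff)
  then show ?thesis
    by (simp add: power2_eq_iff_nonneg)
qed

lemma scaleC_zero_right [simp]: "a *\<^sub>C 0 = (0::'a::chilbert_space)"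
  using scaleC_add_right[of a "0::'a" 0] by simp

lemma scaleC_minus_right: "a *\<^sub>C (- x) = - (a *\<^sub>C x)" for x :: "'a::chilbert_space"
  using scaleC_add_right[of a x "-x"] by (simp add: minus_unique)

lemma scaleC_diff_right: "a *\<^sub>C (x - y) = a *\<^sub>C x - a *\<^sub>C y" for x y :: "'a::chilbert_space"
  using scaleC_add_right[of a x "-y"] by (simp add: scaleC_minus_right)

lemma scaleC_scaleR_commute: "a *\<^sub>C (r *\<^sub>R x) = r *\<^sub>R (a *\<^sub>C x)"
  for x :: "'a::chilbert_space"
  by (simp add: scaleR_scaleC scaleC_scaleC mult.commute)

lemma cinner_ext: "(\<And>z. cinner x z = cinner y z) \<Longrightarrow> x = y" for x y :: "'a::chilbert_space"
  using cinner_eq_zero_iff[of "x - y"] by (simp add: cinner_diff_left)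

definition hermitian :: "('a::chilbert_space \<Rightarrow>\<^sub>L 'a) \<Rightarrow> bool"
  where "hermitian A \<longleftrightarrow> A \<in> bounded_ops \<and> (\<forall>x y. cinner (A x) y = cinner x (A y))"

definition qform :: "('a::chilbert_space \<Rightarrow>\<^sub>L 'a) \<Rightarrow> 'a \<Rightarrow> real"
  where "qform A x = Re (cinner (A x) x)"

text \<open>
  Positivity with symmetry built in: on a complex space real values of the quadratic form already
  force symmetry, but carrying it along saves the polarisation argument.
\<close>

definition psd :: "('a::chilbert_space \<Rightarrow>\<^sub>L 'a) \<Rightarrow> bool"
  where "psd A \<longleftrightarrow> hermitian A \<and> (\<forall>x. 0 \<le> qform A x)"

lemma bounded_ops_scaleC: "A \<in> bounded_ops \<Longrightarrow> A (c *\<^sub>C x) = c *\<^sub>C A x"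
  by (simp add: bounded_ops_def)

lemma hermitianD: "hermitian A \<Longrightarrow> cinner (A x) y = cinner x (A y)"
  by (simp add: hermitian_def)

lemma bounded_ops_algebra:
  assumes "A \<in> bounded_ops" "B \<in> bounded_ops"
  shows "A + B \<in> bounded_ops" "A - B \<in> bounded_ops" "r *\<^sub>R A \<in> bounded_ops"
    "A o\<^sub>L B \<in> bounded_ops"
  using assms by (auto simp: bounded_ops_def plus_blinfun.rep_eq minus_blinfun.rep_eq
      scaleR_blinfun.rep_eq scaleC_add_right scaleC_diff_right scaleC_scaleR_commute)

lemma hermitian_id [simp]: "hermitian id_blinfun"
  by (simp add: hermitian_def bounded_ops_def)

lemma hermitian_zero [simp]: "hermitian 0"
  by (simp add: hermitian_def bounded_ops_def zero_blinfun.rep_eq)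

lemma hermitian_add: "hermitian A \<Longrightarrow> hermitian B \<Longrightarrow> hermitian (A + B)"
  by (simp add: hermitian_def bounded_ops_algebra plus_blinfun.rep_eq cinner_simps)

lemma hermitian_diff: "hermitian A \<Longrightarrow> hermitian B \<Longrightarrow> hermitian (A - B)"
  by (simp add: hermitian_def bounded_ops_algebra minus_blinfun.rep_eq cinner_simps)

lemma hermitian_scaleR: "hermitian A \<Longrightarrow> hermitian (r *\<^sub>R A)"
  by (auto simp: hermitian_def scaleR_blinfun.rep_eq cinner_simps bounded_ops_def
      scaleC_scaleR_commute)

lemma qform_simps:
  "qform (A + B) x = qform A x + qform B x"
  "qform (A - B) x = qform A x - qform B x"
  "qform (r *\<^sub>R A) x = r * qform A x"
  "qform id_blinfun x = (norm x)\<^sup>2"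
  "qform 0 x = 0"
  by (simp_all add: qform_def plus_blinfun.rep_eq minus_blinfun.rep_eq zero_blinfun.rep_eq
      scaleR_blinfun.rep_eq cinner_simps Re_cinner_self)

lemma qform_sum: "qform (\<Sum>i\<in>I. A i) x = (\<Sum>i\<in>I. qform (A i) x)"
  by (induction I rule: infinite_finite_induct) (simp_all add: qform_simps)

lemma hermitian_cinner_self: "hermitian A \<Longrightarrow> cinner (A x) x = of_real (qform A x)"
  using arg_cong[OF cinner_commute[of "A x" x], of Im] hermitianD[of A x x]
  by (simp add: complex_eq_iff qform_def)

lemma psd_iff_positive_op: "hermitian A \<Longrightarrow> psd A \<longleftrightarrow> positive_op A"
  by (auto simp: psd_def positive_op_def hermitian_cinner_self) (auto simp: hermitian_def)

lemma psd_add: "psd A \<Longrightarrow> psd B \<Longrightarrow> psd (A + B)"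
  by (simp add: psd_def hermitian_add qform_simps)

lemma psd_scaleR: "psd A \<Longrightarrow> 0 \<le> r \<Longrightarrow> psd (r *\<^sub>R A)"
  by (simp add: psd_def hermitian_scaleR qform_simps)

lemma psd_id [simp]: "psd id_blinfun"
  by (simp add: psd_def qform_simps)

lemma psd_sum: "(\<And>i. i \<in> I \<Longrightarrow> psd (A i)) \<Longrightarrow> psd (\<Sum>i\<in>I. A i)"
  by (induction I rule: infinite_finite_induct) (simp_all add: psd_add psd_def[of 0] qform_simps)

text \<open>
  The usual discriminant argument for the semidefinite form \<open>\<langle>Ax, y\<rangle>\<close>; taking \<open>A = I\<close> gives the
  classical inequality, general \<open>A\<close> controls operator norms by quadratic forms.
\<close>

lemma psd_Cauchy_Schwarz:
  assumes A: "psd A"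
  shows "(cmod (cinner (A x) y))\<^sup>2 \<le> qform A x * qform A y"
proof -
  define w where "w = cinner (A x) y"
  have H: "hermitian A" and nonneg: "\<And>z. 0 \<le> qform A z"
    using A by (auto simp: psd_def)
  have yx: "cinner (A y) x = cnj w"
    using cinner_commute[of "A y" x] hermitianD[OF H, of x y] by (simp add: w_def)
  have *: "0 \<le> qform A x - 2 * t * (cmod w)\<^sup>2 + t\<^sup>2 * (cmod w)\<^sup>2 * qform A y" for t :: real
  proof -
    define c where "c = of_real (- t) * w"
    have "cinner (A (x + c *\<^sub>C y)) (x + c *\<^sub>C y)
        = cinner (A x) x + cnj c * w + c * cnj w + c * cnj c * cinner (A y) y"
      using bounded_ops_scaleC[of A c y] H[unfolded hermitian_def, THEN conjunct1]
      by (simp add: blinfun.add_right cinner_simps w_def[symmetric] yx)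
        (simp add: algebra_simps)
    then have "qform A (x + c *\<^sub>C y) = Re (cinner (A x) x + cnj c * w + c * cnj w + c * cnj c * cinner (A y) y)"
      by (simp only: qform_def)
    also have "\<dots> = qform A x - 2 * t * (cmod w)\<^sup>2 + t\<^sup>2 * (cmod w)\<^sup>2 * qform A y"
      unfolding hermitian_cinner_self[OF H] c_def
      by (simp add: cmod_power2) (simp add: power2_eq_square algebra_simps)
    finally show ?thesis
      using nonneg[of "x + c *\<^sub>C y"] by simp
  qed
  show ?thesis
  proof (cases "qform A y = 0")
    case True
    have "(cmod w)\<^sup>2 = 0"
    proof (rule ccontr)
      assume "(cmod w)\<^sup>2 \<noteq> 0"
      then show False
        using *[of "(qform A x + 1) / (2 * (cmod w)\<^sup>2)"] True by (simp add: field_simps)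
    qed
    then show ?thesis
      using True by (simp add: w_def)
  next
    case False
    then have pos: "0 < qform A y"
      using nonneg[of y] by simp
    have "0 \<le> qform A x - (cmod w)\<^sup>2 / qform A y"
      using *[of "1 / qform A y"] pos by (simp add: power2_eq_square field_simps)
    then show ?thesis
      using pos by (simp add: w_def field_simps)
  qed
qed

lemma cinner_Cauchy_Schwarz: "cmod (cinner x y) \<le> norm x * norm y"
  for x y :: "'a::chilbert_space"
proof (rule power2_le_imp_le)
  show "(cmod (cinner x y))\<^sup>2 \<le> (norm x * norm y)\<^sup>2"
    using psd_Cauchy_Schwarz[OF psd_id, of x y] by (simp add: qform_simps power_mult_distrib)
qed simp

lemma bounded_bilinear_cinner: "bounded_bilinear (cinner :: 'a::chilbert_space \<Rightarrow> 'a \<Rightarrow> complex)"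
  by standard
    (auto simp: cinner_simps scaleR_conv_of_real intro!: exI[of _ 1] cinner_Cauchy_Schwarz)

lemmas tendsto_cinner [tendsto_intros] = bounded_bilinear.tendsto[OF bounded_bilinear_cinner]

lemma tendsto_qform [tendsto_intros]:
  "(A \<longlongrightarrow> B) F \<Longrightarrow> (x \<longlongrightarrow> y) F \<Longrightarrow> ((\<lambda>k. qform (A k) (x k)) \<longlongrightarrow> qform B y) F"
  unfolding qform_def by (intro tendsto_intros blinfun.tendsto)

lemma qform_le_norm: "qform A x \<le> norm A * (norm x)\<^sup>2"
proof -
  have "qform A x \<le> norm (A x) * norm x"
    unfolding qform_def by (meson cinner_Cauchy_Schwarz complex_Re_le_cmod order_trans)
  also have "\<dots> \<le> norm A * norm x * norm x"
    by (intro mult_right_mono norm_blinfun) auto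
  finally show ?thesis
    by (simp add: power2_eq_square mult.assoc)
qed

text \<open>Cauchy-Schwarz at \<open>y = Ax\<close>: \<open>\<parallel>Ax\<parallel>\<^sup>4 \<le> \<langle>Ax, x\<rangle> \<langle>A(Ax), Ax\<rangle> \<le> K\<^sup>2 \<parallel>x\<parallel>\<^sup>2 \<parallel>Ax\<parallel>\<^sup>2\<close>.\<close>

lemma norm_psd_le:
  assumes A: "psd A" and K: "\<And>x. qform A x \<le> K * (norm x)\<^sup>2" and "0 \<le> K"
  shows "norm A \<le> K"
proof (rule norm_blinfun_bound)
  fix x
  have nonneg: "0 \<le> qform A z" for z
    using A by (simp add: psd_def)
  have "((norm (A x))\<^sup>2)\<^sup>2 = (cmod (cinner (A x) (A x)))\<^sup>2"
    by (simp add: cinner_self norm_power)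
  also have "\<dots> \<le> (K * (norm x)\<^sup>2) * (K * (norm (A x))\<^sup>2)"
    by (intro order_trans[OF psd_Cauchy_Schwarz[OF A]] mult_mono K nonneg mult_nonneg_nonneg)
      (use \<open>0 \<le> K\<close> in auto)
  finally have "(norm (A x))\<^sup>2 * (norm (A x))\<^sup>2 \<le> (K * norm x)\<^sup>2 * (norm (A x))\<^sup>2"
    by (simp add: power2_eq_square algebra_simps)
  then have "A x \<noteq> 0 \<Longrightarrow> (norm (A x))\<^sup>2 \<le> (K * norm x)\<^sup>2"
    by (rule mult_right_le_imp_le) simp
  then show "norm (A x) \<le> K * norm x"
    using \<open>0 \<le> K\<close> by (cases "A x = 0") (auto intro: power2_le_imp_le)
qed fact

lemma norm_mono_psd:
  assumes A: "psd A" and le: "\<And>x. qform A x \<le> qform B x"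
  shows "norm A \<le> norm B"
  using order_trans[OF le qform_le_norm] by (intro norm_psd_le A) auto

lemma hermitian_limit:
  assumes lim: "A \<longlonglongrightarrow> B" and A: "\<And>k. hermitian (A k)"
  shows "hermitian B"
proof -
  have app: "(\<lambda>k. A k x) \<longlonglongrightarrow> B x" for x
    by (intro tendsto_intros blinfun.tendsto lim)
  have "B (c *\<^sub>C x) = c *\<^sub>C B x" for c x
  proof (rule cinner_ext)
    fix z
    have "(\<lambda>k. cinner (A k (c *\<^sub>C x)) z) \<longlonglongrightarrow> cinner (B (c *\<^sub>C x)) z"
      by (intro tendsto_intros app)
    moreover have "(\<lambda>k. c * cinner (A k x) z) \<longlonglongrightarrow> c * cinner (B x) z"
      by (intro tendsto_intros app)
    moreover have "cinner (A k (c *\<^sub>C x)) z = c * cinner (A k x) z" for k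
      using A[of k] by (simp add: hermitian_def bounded_ops_scaleC cinner_simps)
    ultimately show "cinner (B (c *\<^sub>C x)) z = cinner (c *\<^sub>C B x) z"
      by (simp add: LIMSEQ_unique cinner_simps)
  qed
  moreover have "cinner (B x) y = cinner x (B y)" for x y
  proof (rule LIMSEQ_unique)
    show "(\<lambda>k. cinner (A k x) y) \<longlonglongrightarrow> cinner (B x) y"
      by (intro tendsto_intros app)
    have "(\<lambda>k. cinner x (A k y)) \<longlonglongrightarrow> cinner x (B y)"
      by (intro tendsto_intros app)
    then show "(\<lambda>k. cinner (A k x) y) \<longlonglongrightarrow> cinner x (B y)"
      by (simp add: hermitianD[OF A])
  qed
  ultimately show ?thesis
    by (simp add: hermitian_def bounded_ops_def)
qed

section \<open>Coercive forms: adjoints and inverses\<close>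

lemma quadratic_nonneg_imp_linear_zero:
  fixes a b :: real
  assumes "\<And>t. 0 \<le> a * t + b * t\<^sup>2"
  shows "a = 0"
proof (rule ccontr)
  assume "a \<noteq> 0"
  define B where "B = \<bar>b\<bar> + 1"
  have "0 < B" "b \<le> B" by (auto simp: B_def)
  (* so close to 0 the linear term outweighs the quadratic one *)
  have "0 \<le> a * (- a / (2 * B)) + b * (- a / (2 * B))\<^sup>2"
    by (rule assms)
  also have "\<dots> \<le> a * (- a / (2 * B)) + B * (- a / (2 * B))\<^sup>2"
    using \<open>b \<le> B\<close> by (intro add_left_mono mult_right_mono) auto
  also have "\<dots> = - (a\<^sup>2 / (4 * B))"
    using \<open>0 < B\<close> by (simp add: field_simps power2_eq_square)
  also have "\<dots> < 0"
    using \<open>0 < B\<close> \<open>a \<noteq> 0\<close> by simp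
  finally show False by simp
qed

text \<open>
  Minimising the energy \<open>\<langle>Bx, x\<rangle> - 2 Re \<phi>(x)\<close>: coercivity and the parallelogram identity make a
  minimising sequence Cauchy, and the first variation at its limit \<open>y\<close> is the asserted identity.
  The case \<open>B = I\<close> is the Riesz representation theorem; the general case makes \<open>B\<close> invertible.
\<close>

lemma coercive_representation:
  fixes B :: "'a::chilbert_space \<Rightarrow>\<^sub>L 'a"
  assumes B: "hermitian B" and c: "0 < c" "\<And>x. c * (norm x)\<^sup>2 \<le> qform B x"
    and \<phi>: "bounded_linear \<phi>" "\<And>a x. \<phi> (a *\<^sub>C x) = a * \<phi> x"
  shows "\<exists>y. \<forall>x. \<phi> x = cinner x (B y)"
proof -
  interpret \<phi>: bounded_linear \<phi> by fact
  obtain K where K: "\<And>x. norm (\<phi> x) \<le> norm x * K" "0 \<le> K"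
    using \<phi>.nonneg_bounded by blast
  define J where "J x = qform B x - 2 * Re (\<phi> x)" for x
  have J_ge: "- (K\<^sup>2 / c) \<le> J x" for x
  proof -
    have "Re (\<phi> x) \<le> norm x * K"
      using K(1)[of x] complex_Re_le_cmod order_trans by blast
    then have "J x \<ge> c * (norm x)\<^sup>2 - 2 * (norm x * K)"
      using c(2)[of x] by (simp add: J_def)
    moreover have "0 \<le> (c * norm x - K)\<^sup>2 / c"
      using \<open>0 < c\<close> by simp
    moreover have "(c * norm x - K)\<^sup>2 / c = c * (norm x)\<^sup>2 - 2 * (norm x * K) + K\<^sup>2 / c"
      using \<open>0 < c\<close> by (simp add: field_simps power2_eq_square)
    ultimately show ?thesis by simp
  qed
  define m where "m = Inf (range J)"
  have bdd: "bdd_below (range J)"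
    using J_ge by (auto intro!: bdd_belowI2)
  have m_le: "m \<le> J x" for x
    unfolding m_def by (intro cInf_lower bdd) auto
  have "\<exists>x. J x < m + 1 / real (Suc k)" for k
  proof -
    have "Inf (range J) < m + 1 / real (Suc k)"
      by (simp add: m_def)
    then show ?thesis
      using cInf_lessD[of "range J" "m + 1 / real (Suc k)"] by auto
  qed
  then obtain X where X: "\<And>k. J (X k) < m + 1 / real (Suc k)"
    by metis
  have sym: "Re (cinner (B x) y) = Re (cinner (B y) x)" for x y
    using hermitianD[OF B, of x y] Re_cinner_commute[of x "B y"] by simp
  have parallelogram: "c / 2 * (norm (x - y))\<^sup>2 \<le> J x + J y - 2 * m" for x y
  proof -
    have "J x + J y - 2 * J ((1/2) *\<^sub>R (x + y)) = qform B (x - y) / 2"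
      using sym[of x y]
      by (simp add: J_def qform_def \<phi>.scaleR \<phi>.add blinfun.scaleR_right blinfun.add_right
          blinfun.diff_right cinner_simps algebra_simps)
    then show ?thesis
      using m_le[of "(1/2) *\<^sub>R (x + y)"] c(2)[of "x - y"] by simp
  qed
  have "Cauchy X"
  proof (rule metric_CauchyI)
    fix e :: real assume "0 < e"
    then have "0 < c * e\<^sup>2 / 4" using \<open>0 < c\<close> by simp
    then obtain N where N: "1 / real (Suc N) < c * e\<^sup>2 / 4"
      using nat_approx_posE by blast
    have small: "J (X k) - m < c * e\<^sup>2 / 4" if "N \<le> k" for k
      using X[of k] N that by (smt (verit) frac_le of_nat_mono of_nat_0_less_iff zero_less_Suc Suc_le_mono)
    have "dist (X i) (X j) < e" if "N \<le> i" "N \<le> j" for i j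
    proof -
      have "c / 2 * (norm (X i - X j))\<^sup>2 < c / 2 * e\<^sup>2"
        using parallelogram[of "X i" "X j"] small[OF that(1)] small[OF that(2)] by simp
      then have "(norm (X i - X j))\<^sup>2 < e\<^sup>2"
        using \<open>0 < c\<close> by simp
      then show ?thesis
        using \<open>0 < e\<close> by (simp add: dist_norm power_less_imp_less_base)
    qed
    then show "\<exists>M. \<forall>i\<ge>M. \<forall>j\<ge>M. dist (X i) (X j) < e" by blast
  qed
  then obtain y where y: "X \<longlonglongrightarrow> y"
    using Cauchy_convergent convergent_def by blast
  have "(\<lambda>k. J (X k)) \<longlonglongrightarrow> J y"
    unfolding J_def by (intro tendsto_intros \<phi>.tendsto y)
  moreover have "(\<lambda>k. m + 1 / real (Suc k)) \<longlonglongrightarrow> m + 0"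
    by (intro tendsto_intros LIMSEQ_Suc[OF lim_inverse_n'])
  ultimately have "J y \<le> m + 0"
    by (rule LIMSEQ_le) (use X less_imp_le in blast)
  have real_part: "Re (\<phi> x) = Re (cinner (B y) x)" for x
  proof -
    have "0 \<le> (2 * (Re (cinner (B y) x) - Re (\<phi> x))) * t + qform B x * t\<^sup>2" for t
    proof -
      have "J (y + t *\<^sub>R x) = J y + (2 * (Re (cinner (B y) x) - Re (\<phi> x))) * t + qform B x * t\<^sup>2"
        using sym[of x y]
        by (simp add: J_def qform_def \<phi>.scaleR \<phi>.add blinfun.scaleR_right blinfun.add_right
            cinner_simps algebra_simps power2_eq_square)
      then show ?thesis
        using m_le[of "y + t *\<^sub>R x"] \<open>J y \<le> m + 0\<close> by simp
    qed
    from quadratic_nonneg_imp_linear_zero[OF this] show ?thesis by simp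
  qed
  have "\<phi> x = cinner x (B y)" for x
  proof -
    (* the imaginary parts come from the real parts at i x *)
    have "Im (\<phi> x) = - Im (cinner (B y) x)"
      using real_part[of "\<i> *\<^sub>C x"] by (simp add: \<phi>(2) cinner_simps)
    then have "\<phi> x = cnj (cinner (B y) x)"
      using real_part[of x] by (simp add: complex_eq_iff)
    then show ?thesis
      by (simp add: cinner_commute[of x])
  qed
  then show ?thesis by blast
qed

lemma cinner_ext_right: "(\<And>z. cinner z x = cinner z y) \<Longrightarrow> x = y" for x y :: "'a::chilbert_space"
  by (rule cinner_ext) (simp add: cinner_commute[of x] cinner_commute[of y])

lemma adj_exists:
  assumes T: "T \<in> bounded_ops"
  shows "\<exists>S\<in>bounded_ops. \<forall>x y. cinner (T x) y = cinner x (blinfun_apply S y)"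
proof -
  have "\<exists>z. \<forall>x. cinner (T x) y = cinner x z" for y
  proof -
    have "bounded_linear (\<lambda>x. cinner (T x) y)"
      by (intro bounded_linear_compose[OF bounded_bilinear.bounded_linear_left
            [OF bounded_bilinear_cinner]] blinfun.bounded_linear_right)
    then show ?thesis
      using coercive_representation[of id_blinfun 1 "\<lambda>x. cinner (T x) y"] T
      by (simp add: qform_simps bounded_ops_scaleC cinner_simps)
  qed
  then obtain S where S: "\<And>x y. cinner (T x) y = cinner x (S y)"
    by metis
  have S_add: "S (x + y) = S x + S y" for x y
    by (rule cinner_ext_right) (simp add: S[symmetric] cinner_simps)
  have S_scaleC: "S (c *\<^sub>C x) = c *\<^sub>C S x" for c x
    by (rule cinner_ext_right) (simp add: S[symmetric] cinner_simps)
  have S_bound: "norm (S y) \<le> norm y * norm T" for y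
  proof (cases "S y = 0")
    case False
    have "norm (S y) * norm (S y) = cmod (cinner (T (S y)) y)"
      by (simp add: S cinner_self norm_power power2_eq_square norm_mult)
    also have "\<dots> \<le> norm (T (S y)) * norm y"
      by (rule cinner_Cauchy_Schwarz)
    also have "\<dots> \<le> (norm T * norm (S y)) * norm y"
      by (intro mult_right_mono norm_blinfun) auto
    finally have "norm (S y) * norm (S y) \<le> (norm y * norm T) * norm (S y)"
      by (simp add: mult_ac)
    then show ?thesis
      by (rule mult_right_le_imp_le) (use False in simp)
  qed simp
  have "bounded_linear S"
    by (rule bounded_linear_intro[OF _ _ S_bound])
      (simp_all add: S_add scaleR_scaleC S_scaleC)
  then have "blinfun_apply (Blinfun S) = S"
    by (rule bounded_linear_Blinfun_apply)
  then show ?thesis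
    by (intro bexI[of _ "Blinfun S"]) (simp_all add: S bounded_ops_def S_scaleC)
qed

lemma adj:
  assumes "T \<in> bounded_ops"
  shows adj_bounded_ops: "adj T \<in> bounded_ops"
    and cinner_adj_right: "cinner x (adj T y) = cinner (T x) y"
proof -
  have "\<exists>!S. S \<in> bounded_ops \<and> (\<forall>x y. cinner (T x) y = cinner x (blinfun_apply S y))"
  proof (rule ex_ex1I)
    show "\<exists>S. S \<in> bounded_ops \<and> (\<forall>x y. cinner (T x) y = cinner x (blinfun_apply S y))"
      using adj_exists[OF assms] by blast
  next
    fix S S' :: "'a \<Rightarrow>\<^sub>L 'a"
    assume "S \<in> bounded_ops \<and> (\<forall>x y. cinner (T x) y = cinner x (S y))"
      "S' \<in> bounded_ops \<and> (\<forall>x y. cinner (T x) y = cinner x (S' y))"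
    then have "cinner x (S y) = cinner x (S' y)" for x y
      by simp
    then show "S = S'"
      by (metis blinfun_eqI cinner_ext_right)
  qed
  then have "adj T \<in> bounded_ops \<and> (\<forall>x y. cinner (T x) y = cinner x (adj T y))"
    unfolding adj_def by (rule theI')
  then show "adj T \<in> bounded_ops" "cinner x (adj T y) = cinner (T x) y"
    by simp_all
qed

lemma cinner_adj_left: "T \<in> bounded_ops \<Longrightarrow> cinner (adj T x) y = cinner x (T y)"
  using cinner_adj_right[of T y x] cinner_commute[of "adj T x" y] cinner_commute[of x "T y"]
  by simp

lemma adj_adj: "T \<in> bounded_ops \<Longrightarrow> adj (adj T) = T"
  by (rule blinfun_eqI, rule cinner_ext_right)
    (simp add: cinner_adj_right cinner_adj_left adj_bounded_ops)

lemma psd_adj_compose: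
  assumes T: "T \<in> bounded_ops"
  shows "psd (adj T o\<^sub>L T)" and "qform (adj T o\<^sub>L T) x = (norm (T x))\<^sup>2"
proof -
  show q: "qform (adj T o\<^sub>L T) x = (norm (T x))\<^sup>2" for x
    by (simp add: qform_def cinner_adj_left T Re_cinner_self)
  then show "psd (adj T o\<^sub>L T)"
    using T by (simp add: psd_def hermitian_def bounded_ops_algebra adj_bounded_ops
        cinner_adj_left cinner_adj_right)
qed

text \<open>
  Surjectivity is the representation of the functionals \<open>\<langle>\<cdot>, y\<rangle>\<close>; coercivity bounds the inverse.
\<close>

lemma coercive_invertible:
  assumes B: "hermitian B" and c: "0 < c" "\<And>x. c * (norm x)\<^sup>2 \<le> qform B x"
  shows "\<exists>S\<in>bounded_ops. \<forall>x. blinfun_apply S (B x) = x \<and> B (blinfun_apply S x) = x"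
proof -
  have below: "c * norm x \<le> norm (B x)" for x
  proof (cases "x = 0")
    case False
    have "c * norm x * norm x \<le> norm (B x) * norm x"
      using order_trans[OF c(2)[of x, unfolded qform_def]
          order_trans[OF complex_Re_le_cmod cinner_Cauchy_Schwarz]]
      by (simp add: power2_eq_square mult.assoc)
    then show ?thesis
      by (rule mult_right_le_imp_le) (use False in simp)
  qed simp
  have inj: "x = y" if "B x = B y" for x y
    using below[of "x - y"] that \<open>0 < c\<close>
    by (simp add: blinfun.diff_right mult_le_0_iff)
  have "\<exists>z. B z = y" for y
  proof -
    have "\<exists>z. \<forall>x. cinner x y = cinner x (B z)"
      by (rule coercive_representation[OF B c])
        (auto simp: cinner_simps bounded_bilinear.bounded_linear_left[OF bounded_bilinear_cinner])
    then show ?thesis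
      by (metis cinner_ext_right)
  qed
  then obtain S where BS: "\<And>y. B (S y) = y"
    by metis
  have SB: "S (B x) = x" for x
    by (rule inj) (simp add: BS)
  have S_scaleC: "S (a *\<^sub>C x) = a *\<^sub>C S x" for a x
    by (rule inj) (simp add: BS bounded_ops_scaleC[OF B[unfolded hermitian_def, THEN conjunct1]])
  have "bounded_linear S"
  proof (rule bounded_linear_intro[where K = "1 / c"])
    show "S (x + y) = S x + S y" for x y
      by (rule inj) (simp add: BS blinfun.add_right)
    show "norm (S x) \<le> norm x * (1 / c)" for x
      using below[of "S x"] \<open>0 < c\<close> by (simp add: BS field_simps)
  qed (simp add: scaleR_scaleC S_scaleC)
  then have "blinfun_apply (Blinfun S) = S"
    by (rule bounded_linear_Blinfun_apply)
  then show ?thesis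
    by (intro bexI[of _ "Blinfun S"]) (simp_all add: BS SB bounded_ops_def S_scaleC)
qed

text \<open>To the left of \<open>a\<close> the operator \<open>A - r\<close> is coercive, to the right of \<open>b\<close> the operator \<open>r - A\<close>.\<close>

lemma real_spectrum_bounds:
  assumes A: "hermitian A" and r: "complex_of_real r \<in> spectrum A"
    and a: "\<And>x. a * (norm x)\<^sup>2 \<le> qform A x" and b: "\<And>x. qform A x \<le> b * (norm x)\<^sup>2"
  shows "r \<in> {a..b}"
proof (rule ccontr)
  assume "r \<notin> {a..b}"
  then consider "r < a" | "b < r" by fastforce
  then show False
  proof cases
    case 1
    have "\<exists>S\<in>bounded_ops. \<forall>x. blinfun_apply S ((A - r *\<^sub>R id_blinfun) x) = x
        \<and> (A - r *\<^sub>R id_blinfun) (blinfun_apply S x) = x"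
      using 1 a by (intro coercive_invertible[of _ "a - r"] hermitian_diff hermitian_scaleR A)
        (simp_all add: qform_simps algebra_simps)
    then show False
      using r by (auto simp: spectrum_def minus_blinfun.rep_eq scaleR_blinfun.rep_eq scaleR_scaleC)
  next
    case 2
    have "\<exists>S\<in>bounded_ops. \<forall>x. blinfun_apply S ((r *\<^sub>R id_blinfun - A) x) = x
        \<and> (r *\<^sub>R id_blinfun - A) (blinfun_apply S x) = x"
      using 2 b by (intro coercive_invertible[of _ "r - b"] hermitian_diff hermitian_scaleR A)
        (simp_all add: qform_simps algebra_simps)
    then obtain S where S: "S \<in> bounded_ops" "\<And>x. blinfun_apply S (r *\<^sub>R x - A x) = x"
      "\<And>x. r *\<^sub>R S x - A (S x) = x"
      by (auto simp: minus_blinfun.rep_eq scaleR_blinfun.rep_eq)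
    have "- S \<in> bounded_ops"
      using S(1) by (simp add: bounded_ops_def uminus_blinfun.rep_eq scaleC_minus_right)
    moreover have "(- S) (A x - r *\<^sub>R x) = x" "A ((- S) x) - r *\<^sub>R (- S) x = x" for x
      using S(2)[of x] S(3)[of x]
      by (simp_all add: uminus_blinfun.rep_eq blinfun.diff_right blinfun.minus_right)
    ultimately show False
      using r by (auto simp: spectrum_def scaleR_scaleC[symmetric])
  qed
qed

section \<open>Polynomials of a hermitian operator\<close>

lemma blinfun_compose_assoc: "(A o\<^sub>L B) o\<^sub>L C = A o\<^sub>L (B o\<^sub>L C)"
  by (rule blinfun_eqI) simp

lemma blinfun_compose_id [simp]: "A o\<^sub>L id_blinfun = A" "id_blinfun o\<^sub>L A = A"
  by (rule blinfun_eqI; simp)+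

lemma poly_op_eq_sum:
  assumes "degree p \<le> n"
  shows "poly_op p A = (\<Sum>i\<le>n. coeff p i *\<^sub>R (((o\<^sub>L) A ^^ i) id_blinfun))"
  unfolding poly_op_def using assms
  by (intro sum.mono_neutral_left) (auto simp: coeff_eq_0)

lemma poly_op_0 [simp]: "poly_op 0 A = 0"
  by (simp add: poly_op_def)

lemma poly_op_add: "poly_op (p + q) A = poly_op p A + poly_op q A"
proof -
  define n where "n = max (degree p) (degree q)"
  have "degree (p + q) \<le> n" "degree p \<le> n" "degree q \<le> n"
    by (auto simp: n_def degree_add_le_max)
  then show ?thesis
    by (simp add: poly_op_eq_sum[of _ n] sum.distrib scaleR_add_left)
qed

lemma poly_op_smult: "poly_op (smult a p) A = a *\<^sub>R poly_op p A"
  by (simp add: poly_op_eq_sum[of _ "degree p"] degree_smult_le scaleR_sum_right)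

lemma poly_op_diff: "poly_op (p - q) A = poly_op p A - poly_op q A"
  using poly_op_add[of "p - q" q A] by simp

lemma poly_op_pCons: "poly_op (pCons a p) A = a *\<^sub>R id_blinfun + (A o\<^sub>L poly_op p A)"
proof -
  have "poly_op (pCons a p) A
      = (\<Sum>i\<le>Suc (degree p). coeff (pCons a p) i *\<^sub>R (((o\<^sub>L) A ^^ i) id_blinfun))"
    by (rule poly_op_eq_sum) (rule degree_pCons_le)
  also have "\<dots> = a *\<^sub>R id_blinfun
      + (\<Sum>i\<le>degree p. coeff p i *\<^sub>R (A o\<^sub>L (((o\<^sub>L) A ^^ i) id_blinfun)))"
    by (simp add: sum.atMost_Suc_shift del: sum.atMost_Suc)
  also have "\<dots> = a *\<^sub>R id_blinfun + (A o\<^sub>L poly_op p A)"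
    unfolding poly_op_def
    by (simp add: bounded_bilinear.sum_right[OF bounded_bilinear_blinfun_compose]
        bounded_bilinear.scaleR_right[OF bounded_bilinear_blinfun_compose])
  finally show ?thesis .
qed

lemma poly_op_mult: "poly_op (p * q) A = poly_op p A o\<^sub>L poly_op q A"
proof (induction p)
  case 0
  show ?case by (simp add: blinfun_eqI zero_blinfun.rep_eq)
next
  case (pCons a p)
  then show ?case
    by (intro blinfun_eqI) (simp add: poly_op_add poly_op_smult poly_op_pCons plus_blinfun.rep_eq
        scaleR_blinfun.rep_eq)
qed

lemma poly_op_intertwine:
  assumes "X o\<^sub>L A = B o\<^sub>L X"
  shows "X o\<^sub>L poly_op p A = poly_op p B o\<^sub>L X"
proof (induction p)
  case 0
  show ?case by (simp add: blinfun_eqI zero_blinfun.rep_eq blinfun.zero_right)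
next
  case (pCons a p)
  show ?case
  proof (rule blinfun_eqI)
    fix x
    have "X (A y) = B (X y)" "X (poly_op p A y) = poly_op p B (X y)" for y
      using assms pCons.IH by (metis blinfun_apply_blinfun_compose)+
    then show "(X o\<^sub>L poly_op (pCons a p) A) x = (poly_op (pCons a p) B o\<^sub>L X) x"
      by (simp add: poly_op_pCons plus_blinfun.rep_eq scaleR_blinfun.rep_eq
          blinfun.add_right blinfun.scaleR_right)
  qed
qed

lemma hermitian_compose:
  assumes "hermitian A" "hermitian B" "A o\<^sub>L B = B o\<^sub>L A"
  shows "hermitian (A o\<^sub>L B)"
proof -
  have "cinner (A (B x)) y = cinner x (A (B y))" for x y
    using assms by (metis blinfun_apply_blinfun_compose hermitianD)
  then show ?thesis
    using assms by (simp add: hermitian_def bounded_ops_algebra)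
qed

lemma hermitian_poly_op: "hermitian A \<Longrightarrow> hermitian (poly_op p A)"
proof (induction p)
  case (pCons a p)
  have "hermitian (A o\<^sub>L poly_op p A)"
    using pCons by (intro hermitian_compose poly_op_intertwine) auto
  then show ?case
    by (simp add: poly_op_pCons hermitian_add hermitian_scaleR)
qed simp

text \<open>
  Failure to be bounded below means that there are approximate null vectors. Unlike
  non-invertibility, it passes to a factor of a product without commutation or surjectivity
  arguments.
\<close>

definition bounded_below :: "('a::real_normed_vector \<Rightarrow>\<^sub>L 'a) \<Rightarrow> bool"
  where "bounded_below A \<longleftrightarrow> (\<exists>c>0. \<forall>x. c * norm x \<le> norm (A x))"

lemma bounded_below_compose:
  assumes "bounded_below A" "bounded_below B"
  shows "bounded_below (A o\<^sub>L B)"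
proof -
  obtain a b where *: "0 < a" "0 < b" "\<And>x. a * norm x \<le> norm (A x)" "\<And>x. b * norm x \<le> norm (B x)"
    using assms by (auto simp: bounded_below_def)
  have "a * b * norm x \<le> norm (A (B x))" for x
    using order_trans[OF mult_left_mono[OF *(4)[of x], of a] *(3)[of "B x"]] *(1)
    by (simp add: mult.assoc)
  then show ?thesis
    using *(1,2) by (auto simp: bounded_below_def intro!: exI[of _ "a * b"])
qed

lemma not_bounded_below_imp_spectrum:
  assumes "\<not> bounded_below (A - r *\<^sub>R id_blinfun)"
  shows "complex_of_real r \<in> spectrum A"
proof (rule ccontr)
  assume "complex_of_real r \<notin> spectrum A"
  then obtain S where "\<forall>x. blinfun_apply S (A x - complex_of_real r *\<^sub>C x) = x
      \<and> A (blinfun_apply S x) - complex_of_real r *\<^sub>C blinfun_apply S x = x"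
    by (simp add: spectrum_def) blast
  then have S: "blinfun_apply S (A x - r *\<^sub>R x) = x" for x
    by (simp add: scaleR_scaleC)
  have "(1 / (norm S + 1)) * norm x \<le> norm (A x - r *\<^sub>R x)" for x
  proof -
    have "norm x \<le> norm S * norm (A x - r *\<^sub>R x)"
      by (metis S norm_blinfun)
    also have "\<dots> \<le> (norm S + 1) * norm (A x - r *\<^sub>R x)"
      by (simp add: mult_right_mono)
    finally show ?thesis
      using norm_ge_zero[of S] by (simp add: field_simps add_pos_nonneg add_nonneg_pos)
  qed
  then have "bounded_below (A - r *\<^sub>R id_blinfun)"
    unfolding bounded_below_def
    by (intro exI[of _ "1 / (norm S + 1)"])
      (simp add: minus_blinfun.rep_eq scaleR_blinfun.rep_eq add_nonneg_pos)
  with assms show False by simp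
qed

lemma map_poly_of_real_add:
  "map_poly complex_of_real (p + q) = map_poly of_real p + map_poly of_real q"
  by (rule poly_eqI) (simp add: coeff_map_poly)

lemma map_poly_of_real_mult:
  "map_poly complex_of_real (p * q) = map_poly of_real p * map_poly of_real q"
  by (rule poly_eqI) (simp add: coeff_map_poly coeff_mult)

text \<open>The remainder is a real polynomial of degree at most one with a nonreal root, hence zero.\<close>

lemma real_poly_dvd_quadratic_of_complex_root:
  fixes q :: "real poly"
  assumes root: "poly (map_poly of_real q) z = 0" and "Im z \<noteq> 0"
  shows "[:(cmod z)\<^sup>2, - 2 * Re z, 1:] dvd q"
proof -
  define d where "d = [:(cmod z)\<^sup>2, - 2 * Re z, 1:]"
  have d0: "poly (map_poly of_real d) z = 0"
    using cmod_power2[of z]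
    by (simp add: d_def map_poly_pCons complex_eq_iff power2_eq_square algebra_simps)
  have "q mod d = 0"
  proof (rule ccontr)
    assume nz: "q mod d \<noteq> 0"
    have "d \<noteq> 0" "degree d = 2" by (auto simp: d_def)
    then have "degree (q mod d) < 2"
      using degree_mod_less[of d q] nz by auto
    then have "coeff (q mod d) i = coeff [:coeff (q mod d) 0, coeff (q mod d) 1:] i" for i
      by (auto simp: coeff_pCons coeff_eq_0 split: nat.split)
    then obtain u v where uv: "q mod d = [:u, v:]"
      using poly_eqI by metis
    have "q = d * (q div d) + q mod d" by simp
    then have "map_poly complex_of_real q
        = map_poly of_real d * map_poly of_real (q div d) + map_poly of_real (q mod d)"
      by (metis map_poly_of_real_add map_poly_of_real_mult)
    then have "poly (map_poly of_real (q mod d)) z = 0"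
      using root d0 by simp
    then have "of_real u + of_real v * z = 0"
      by (simp add: uv map_poly_pCons mult.commute)
    then have "v = 0" "u = 0"
      using \<open>Im z \<noteq> 0\<close> by (auto simp: complex_eq_iff)
    then show False
      using nz uv by simp
  qed
  then show ?thesis
    by (simp add: d_def dvd_eq_mod_eq_0)
qed

lemma poly_op_linear: "poly_op [:- r, 1:] A = A - r *\<^sub>R id_blinfun"
  by (simp add: poly_op_pCons)

lemma poly_op_const: "poly_op [:c:] A = c *\<^sub>R id_blinfun"
  by (simp add: poly_op_pCons)

lemma poly_op_X: "poly_op [:0, 1:] A = A"
  by (simp add: poly_op_pCons)

lemma norm_sq_hermitian: "hermitian A \<Longrightarrow> (norm (A x))\<^sup>2 = Re (cinner (A (A x)) x)"
  by (metis Re_cinner_self hermitianD)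

text \<open>The polynomial is \<open>(X - z)(X - z\<^sup>*) = (X - Re z)\<^sup>2 + (Im z)\<^sup>2\<close>, and squares of hermitian operators are positive.\<close>

lemma bounded_below_quadratic:
  assumes A: "hermitian A" and "Im z \<noteq> 0"
  shows "bounded_below (poly_op [:(cmod z)\<^sup>2, - 2 * Re z, 1:] A)"
proof -
  let ?Q = "poly_op [:(cmod z)\<^sup>2, - 2 * Re z, 1:] A"
  define B where "B = A - Re z *\<^sub>R id_blinfun"
  have B: "hermitian B"
    by (simp add: B_def A hermitian_diff hermitian_scaleR)
  have Q: "?Q x = B (B x) + (Im z)\<^sup>2 *\<^sub>R x" for x
    by (simp add: B_def poly_op_pCons plus_blinfun.rep_eq minus_blinfun.rep_eq
        scaleR_blinfun.rep_eq blinfun.diff_right blinfun.add_right blinfun.scaleR_right cmod_power2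
        algebra_simps)
      (simp add: power2_eq_square scaleR_left_distrib[symmetric])
  have "(Im z)\<^sup>2 * norm x \<le> norm (?Q x)" for x
  proof (cases "x = 0")
    case False
    have "(Im z)\<^sup>2 * norm x * norm x \<le> (norm (B x))\<^sup>2 + (Im z)\<^sup>2 * (norm x)\<^sup>2"
      by (simp add: power2_eq_square)
    also have "\<dots> = Re (cinner (?Q x) x)"
      unfolding Q by (simp add: cinner_simps norm_sq_hermitian[OF B] Re_cinner_self)
    also have "\<dots> \<le> norm (?Q x) * norm x"
      using cinner_Cauchy_Schwarz complex_Re_le_cmod order_trans by blast
    finally show ?thesis
      by (rule mult_right_le_imp_le) (use False in simp)
  qed simp
  then show ?thesis
    using \<open>Im z \<noteq> 0\<close> unfolding bounded_below_def by (intro exI[of _ "(Im z)\<^sup>2"]) simp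
qed

lemma of_real_poly_eq: "complex_of_real (poly q r) = poly (map_poly of_real q) (of_real r)"
  by (induction q) (simp_all add: map_poly_pCons)

text \<open>
  Split off the factors of \<open>q\<close> one at a time: a real root contributes a factor that is bounded
  below by hypothesis, a pair of conjugate roots a quadratic one that always is.
\<close>

lemma bounded_below_poly_op:
  assumes A: "hermitian A" and "q \<noteq> 0"
    and "\<And>r. poly q r = 0 \<Longrightarrow> bounded_below (A - r *\<^sub>R id_blinfun)"
  shows "bounded_below (poly_op q A)"
  using assms(2,3)
proof (induction "degree q" arbitrary: q rule: less_induct)
  case less
  have step: "bounded_below (poly_op q A)"
    if "d dvd q" "0 < degree d" "bounded_below (poly_op d A)" for d
  proof -
    obtain p where p: "q = d * p"
      using \<open>d dvd q\<close> by blast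
    with less.prems(1) have "p \<noteq> 0" "d \<noteq> 0" by auto
    then have "degree p < degree q"
      using \<open>0 < degree d\<close> by (simp add: p degree_mult_eq)
    moreover have "bounded_below (A - r *\<^sub>R id_blinfun)" if "poly p r = 0" for r
      using less.prems(2)[of r] that by (simp add: p)
    ultimately have "bounded_below (poly_op p A)"
      using less.hyps \<open>p \<noteq> 0\<close> by blast
    then show ?thesis
      by (simp add: p poly_op_mult bounded_below_compose that)
  qed
  show ?case
  proof (cases "degree q = 0")
    case True
    then obtain c where c: "q = [:c:]"
      by (rule degree_eq_zeroE)
    with less.prems(1) have "0 < \<bar>c\<bar>" by auto
    then show ?thesis
      unfolding c poly_op_const bounded_below_def
      by (intro exI[of _ "\<bar>c\<bar>"]) (simp add: scaleR_blinfun.rep_eq)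
  next
    case False
    let ?Q = "map_poly complex_of_real q"
    have "degree ?Q \<noteq> 0"
      using False by (simp add: degree_map_poly)
    then have "\<not> constant (poly ?Q)"
      by (simp add: constant_degree)
    then obtain z where z: "poly ?Q z = 0"
      using fundamental_theorem_of_algebra by blast
    show ?thesis
    proof (cases "Im z = 0")
      case True
      then have "z = complex_of_real (Re z)"
        by (simp add: complex_eq_iff)
      then have "complex_of_real (poly q (Re z)) = 0"
        using z by (metis of_real_poly_eq)
      then have "poly q (Re z) = 0" by simp
      then have "[:- Re z, 1:] dvd q" "bounded_below (poly_op [:- Re z, 1:] A)"
        using less.prems(2) by (simp_all add: poly_eq_0_iff_dvd poly_op_linear)
      then show ?thesis
        by (intro step) auto
    next
      case False
      have "[:(cmod z)\<^sup>2, - 2 * Re z, 1:] dvd q"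
        using z False by (rule real_poly_dvd_quadratic_of_complex_root)
      then show ?thesis
        by (rule step) (simp_all only: bounded_below_quadratic[OF A False], simp)
    qed
  qed
qed

text \<open>
  On unit vectors that nearly attain the norm \<open>M\<close> of \<open>S\<close>,
  \<open>\<parallel>(M\<^sup>2 - S\<^sup>2)x\<parallel>\<^sup>2 \<le> M\<^sup>2(M\<^sup>2 - \<parallel>Sx\<parallel>\<^sup>2)\<close> is nearly zero.
\<close>

lemma not_bounded_below_norm_sq:
  assumes S: "hermitian S" and "S \<noteq> 0"
  shows "\<not> bounded_below ((norm S)\<^sup>2 *\<^sub>R id_blinfun - (S o\<^sub>L S))"
proof
  define M where "M = norm S"
  have "0 < M" using \<open>S \<noteq> 0\<close> by (simp add: M_def)
  assume "bounded_below ((norm S)\<^sup>2 *\<^sub>R id_blinfun - (S o\<^sub>L S))"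
  then obtain c where "0 < c" and c: "\<And>x. c * norm x \<le> norm (M\<^sup>2 *\<^sub>R x - S (S x))"
    by (auto simp: bounded_below_def M_def minus_blinfun.rep_eq scaleR_blinfun.rep_eq)
  define K where "K = sqrt (max 0 (M\<^sup>2 - c\<^sup>2 / M\<^sup>2))"
  have "norm (S x) \<le> K * norm x" for x
  proof -
    have "c\<^sup>2 * (norm x)\<^sup>2 \<le> (norm (M\<^sup>2 *\<^sub>R x - S (S x)))\<^sup>2"
      using power_mono[OF c[of x], of 2] \<open>0 < c\<close> by (simp add: power_mult_distrib)
    also have "\<dots> = M^4 * (norm x)\<^sup>2 - 2 * M\<^sup>2 * (norm (S x))\<^sup>2 + (norm (S (S x)))\<^sup>2"
    proof -
      have "Re (cinner x (S (S x))) = (norm (S x))\<^sup>2"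
        by (simp add: norm_sq_hermitian[OF S] Re_cinner_commute)
      then show ?thesis
        by (simp add: Re_cinner_self[symmetric, of "M\<^sup>2 *\<^sub>R x - S (S x)"] cinner_simps
            norm_sq_hermitian[OF S, symmetric] Re_cinner_self)
          (simp add: power2_eq_square power4_eq_xxxx algebra_simps)
    qed
    also have "\<dots> \<le> M^4 * (norm x)\<^sup>2 - 2 * M\<^sup>2 * (norm (S x))\<^sup>2 + M\<^sup>2 * (norm (S x))\<^sup>2"
      using power_mono[OF norm_blinfun[of S "S x"], of 2]
      by (simp add: M_def power_mult_distrib)
    also have "\<dots> = M\<^sup>2 * (M\<^sup>2 * (norm x)\<^sup>2 - (norm (S x))\<^sup>2)"
      by (simp add: power2_eq_square power4_eq_xxxx algebra_simps)
    finally have "c\<^sup>2 / M\<^sup>2 * (norm x)\<^sup>2 \<le> M\<^sup>2 * (norm x)\<^sup>2 - (norm (S x))\<^sup>2"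
      using \<open>0 < M\<close> by (simp add: field_simps)
    then have "(norm (S x))\<^sup>2 \<le> (M\<^sup>2 - c\<^sup>2 / M\<^sup>2) * (norm x)\<^sup>2"
      by (simp add: algebra_simps)
    also have "\<dots> \<le> max 0 (M\<^sup>2 - c\<^sup>2 / M\<^sup>2) * (norm x)\<^sup>2"
      by (intro mult_right_mono) auto
    also have "\<dots> = (K * norm x)\<^sup>2"
      by (simp add: K_def power_mult_distrib)
    finally show ?thesis
      by (rule power2_le_imp_le) (simp add: K_def)
  qed
  then have "M \<le> K"
    unfolding M_def by (intro norm_blinfun_bound) (auto simp: K_def)
  then have "M\<^sup>2 \<le> K\<^sup>2"
    using \<open>0 < M\<close> by (intro power_mono) auto
  then show False
    using \<open>0 < M\<close> \<open>0 < c\<close> by (auto simp: K_def max_def divide_simps split: if_splits)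
qed

text \<open>
  With \<open>M = \<parallel>p(A)\<parallel>\<close>, the operator \<open>M\<^sup>2 - p(A)\<^sup>2\<close> is not bounded below, so unless
  \<open>p\<close> is constant, \<open>bounded_below_poly_op\<close> yields a real root \<open>r\<close> of \<open>M\<^sup>2 - p\<^sup>2\<close> in the spectrum, and
  there \<open>\<bar>p(r)\<bar> = M\<close>.
\<close>

lemma norm_poly_op_le:
  assumes A: "hermitian A" and bound: "\<And>r. complex_of_real r \<in> spectrum A \<Longrightarrow> \<bar>poly p r\<bar> \<le> c"
    and "0 \<le> c"
  shows "norm (poly_op p A) \<le> c"
proof (cases "poly_op p A = 0")
  case True
  then show ?thesis using \<open>0 \<le> c\<close> by simp
next
  case False
  have root: "\<exists>r. complex_of_real r \<in> spectrum A \<and> \<bar>poly s r\<bar> = norm (poly_op s A)"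
    if nz: "poly_op s A \<noteq> 0" "[:(norm (poly_op s A))\<^sup>2:] - s * s \<noteq> 0" for s
  proof -
    have "\<not> bounded_below (poly_op ([:(norm (poly_op s A))\<^sup>2:] - s * s) A)"
      using not_bounded_below_norm_sq[OF hermitian_poly_op[OF A] nz(1)]
      by (simp add: poly_op_diff poly_op_mult poly_op_const)
    then obtain r where "poly ([:(norm (poly_op s A))\<^sup>2:] - s * s) r = 0"
      and r: "\<not> bounded_below (A - r *\<^sub>R id_blinfun)"
      using bounded_below_poly_op[OF A nz(2)] by blast
    then have "(poly s r)\<^sup>2 = (norm (poly_op s A))\<^sup>2"
      by (simp add: power2_eq_square)
    then have "\<bar>poly s r\<bar> = norm (poly_op s A)"
      by (metis abs_norm_cancel power2_eq_iff abs_minus_cancel)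
    with r show ?thesis
      using not_bounded_below_imp_spectrum by blast
  qed
  show ?thesis
  proof (cases "[:(norm (poly_op p A))\<^sup>2:] - p * p = 0")
    case False
    then show ?thesis
      using root[OF \<open>poly_op p A \<noteq> 0\<close>] bound by metis
  next
    (* p is constant: any point of the spectrum will do *)
    case True
    then have "poly ([:(norm (poly_op p A))\<^sup>2:] - p * p) r = 0" for r
      by simp
    then have "(poly p r)\<^sup>2 = (norm (poly_op p A))\<^sup>2" for r
      by (simp add: power2_eq_square)
    then have const: "\<bar>poly p r\<bar> = norm (poly_op p A)" for r
      by (metis abs_norm_cancel power2_eq_iff abs_minus_cancel)
    have "\<exists>r. complex_of_real r \<in> spectrum A"
    proof (cases "A = 0")
      case True
      obtain x where x: "poly_op p A x \<noteq> 0"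
        using \<open>poly_op p A \<noteq> 0\<close> by (metis blinfun_eqI zero_blinfun.rep_eq)
      then have "x \<noteq> 0" by (auto simp: blinfun.zero_right)
      then have "\<not> bounded_below (A - 0 *\<^sub>R id_blinfun)"
        by (auto simp: True bounded_below_def zero_blinfun.rep_eq not_le intro!: exI[of _ x])
      then show ?thesis
        using not_bounded_below_imp_spectrum by blast
    next
      case False
      then show ?thesis
        using root[of "[:0, 1:]"] by (auto simp: poly_op_X)
    qed
    then show ?thesis
      using bound const by metis
  qed
qed

section \<open>The continuous functional calculus\<close>

abbreviation real_spectrum :: "('a::chilbert_space \<Rightarrow>\<^sub>L 'a) \<Rightarrow> real set"
  where "real_spectrum A \<equiv> {r. complex_of_real r \<in> spectrum A}"

lemma poly_op_tendsto_zero: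
  assumes A: "hermitian A" and lim: "uniform_limit (real_spectrum A) (\<lambda>k. poly (p k)) (\<lambda>_. 0) sequentially"
  shows "(\<lambda>k. poly_op (p k) A) \<longlonglongrightarrow> 0"
proof (rule LIMSEQ_I)
  fix e :: real assume "0 < e"
  then have "\<forall>\<^sub>F k in sequentially. \<forall>r\<in>real_spectrum A. dist (poly (p k) r) 0 < e / 2"
    using uniform_limitD[OF lim, of "e/2"] by simp
  then obtain N where N: "\<And>k r. N \<le> k \<Longrightarrow> r \<in> real_spectrum A \<Longrightarrow> \<bar>poly (p k) r\<bar> < e / 2"
    by (auto simp: eventually_sequentially)
  have "norm (poly_op (p k) A) \<le> e / 2" if "N \<le> k" for k
    using N[OF that] \<open>0 < e\<close> by (intro norm_poly_op_le[OF A]) (auto intro: less_imp_le)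
  then show "\<exists>N. \<forall>k\<ge>N. norm (poly_op (p k) A - 0) < e"
    using \<open>0 < e\<close> by (intro exI[of _ N]) fastforce
qed

text \<open>Two approximating sequences of polynomials differ by one that tends to zero uniformly.\<close>

lemma cfc_eqI:
  assumes A: "hermitian A"
    and p: "uniform_limit (real_spectrum A) (\<lambda>k. poly (p k)) f sequentially"
    and B: "(\<lambda>k. poly_op (p k) A) \<longlonglongrightarrow> B"
  shows "cfc f A = B"
  unfolding cfc_def
proof (rule the_equality)
  show "\<exists>p. uniform_limit (real_spectrum A) (\<lambda>k. poly (p k)) f sequentially \<and>
      (\<lambda>k. poly_op (p k) A) \<longlonglongrightarrow> B"
    using p B by blast
next
  fix C
  assume "\<exists>p. uniform_limit (real_spectrum A) (\<lambda>k. poly (p k)) f sequentially \<and>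
      (\<lambda>k. poly_op (p k) A) \<longlonglongrightarrow> C"
  then obtain q where q: "uniform_limit (real_spectrum A) (\<lambda>k. poly (q k)) f sequentially"
    and C: "(\<lambda>k. poly_op (q k) A) \<longlonglongrightarrow> C"
    by blast
  have "uniform_limit (real_spectrum A) (\<lambda>k. poly (q k - p k)) (\<lambda>_. 0) sequentially"
    using uniform_limit_minus[OF q p] by (simp add: poly_diff[abs_def])
  then have "(\<lambda>k. poly_op (q k - p k) A) \<longlonglongrightarrow> 0"
    by (rule poly_op_tendsto_zero[OF A])
  moreover have "(\<lambda>k. poly_op (q k - p k) A) \<longlonglongrightarrow> C - B"
    unfolding poly_op_diff by (intro tendsto_diff B C)
  ultimately show "C = B"
    using LIMSEQ_unique by fastforce
qed

lemma Weierstrass_uniform_limit: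
  fixes f :: "real \<Rightarrow> real"
  assumes "continuous_on {a..b} f"
  shows "\<exists>p. uniform_limit {a..b} (\<lambda>k. poly (p k)) f sequentially"
proof -
  have "\<exists>p. \<forall>x\<in>{a..b}. \<bar>f x - poly p x\<bar> < 1 / real (Suc k)" for k
  proof -
    obtain g where g: "real_polynomial_function g" "\<And>x. x \<in> {a..b} \<Longrightarrow> \<bar>f x - g x\<bar> < 1 / real (Suc k)"
      using Stone_Weierstrass_real_polynomial_function[of "{a..b}" f "1 / real (Suc k)"] assms
      by auto
    then obtain c n where "g = (\<lambda>x. \<Sum>i\<le>n. c i * x ^ i)"
      using real_polynomial_function_iff_sum by blast
    then have "g = poly (\<Sum>i\<le>n. monom (c i) i)"
      by (simp add: poly_sum poly_monom fun_eq_iff)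
    then show ?thesis
      using g(2) by blast
  qed
  then obtain p where p: "\<And>k x. x \<in> {a..b} \<Longrightarrow> \<bar>f x - poly (p k) x\<bar> < 1 / real (Suc k)"
    by metis
  have "uniform_limit {a..b} (\<lambda>k. poly (p k)) f sequentially"
  proof (rule uniform_limitI)
    fix e :: real assume "0 < e"
    then obtain N where N: "1 / real (Suc N) < e"
      using nat_approx_posE by blast
    have "dist (poly (p k) x) (f x) < e" if "N \<le> k" "x \<in> {a..b}" for k x
    proof -
      have "1 / real (Suc k) \<le> 1 / real (Suc N)"
        using that by (simp add: frac_le)
      then show ?thesis
        using p[of x k] that N by (simp add: dist_real_def abs_minus_commute)
    qed
    then show "\<forall>\<^sub>F k in sequentially. \<forall>x\<in>{a..b}. dist (poly (p k) x) (f x) < e"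
      unfolding eventually_sequentially by blast
  qed
  then show ?thesis by blast
qed

lemma real_spectrum_psd: "psd A \<Longrightarrow> real_spectrum A \<subseteq> {0..norm A}"
  using real_spectrum_bounds[of A _ 0 "norm A"] by (auto simp: psd_def qform_le_norm)

lemma norm_poly_op_psd_le:
  assumes A: "psd A" "norm A \<le> M" and "\<And>r. r \<in> {0..M} \<Longrightarrow> \<bar>poly p r\<bar> \<le> c"
  shows "norm (poly_op p A) \<le> c"
proof (rule norm_poly_op_le)
  show "hermitian A" using A by (simp add: psd_def)
  show "\<bar>poly p r\<bar> \<le> c" if "complex_of_real r \<in> spectrum A" for r
    using assms(3)[of r] real_spectrum_psd[OF A(1)] that A(2) by fastforce
  show "0 \<le> c"
    using assms(3)[of 0] A(2) norm_ge_zero[of A] by (smt (verit) atLeastAtMost_iff)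
qed

text \<open>
  The norm estimate turns a uniformly Cauchy sequence of polynomials into a Cauchy sequence of
  operators. The interval \<open>[0, M]\<close> may be larger than needed for \<open>A\<close>, so that one sequence of
  polynomials can serve several operators at once.
\<close>

lemma cfc_limit:
  assumes A: "psd A" "norm A \<le> M"
    and p: "uniform_limit {0..M} (\<lambda>k. poly (p k)) f sequentially"
  shows "(\<lambda>k. poly_op (p k) A) \<longlonglongrightarrow> cfc f A"
proof -
  have H: "hermitian A" using A by (simp add: psd_def)
  have "Cauchy (\<lambda>k. poly_op (p k) A)"
  proof (rule metric_CauchyI)
    fix e :: real assume "0 < e"
    have "uniformly_Cauchy_on {0..M} (\<lambda>k. poly (p k))"
      using p by (rule uniformly_convergent_Cauchy[OF uniformly_convergentI])
    then obtain N where N: "\<And>r i j. r \<in> {0..M} \<Longrightarrow> N \<le> i \<Longrightarrow> N \<le> j \<Longrightarrow>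
        dist (poly (p i) r) (poly (p j) r) < e / 2"
      using \<open>0 < e\<close> unfolding uniformly_Cauchy_on_def by (meson half_gt_zero)
    have "dist (poly_op (p i) A) (poly_op (p j) A) < e" if "N \<le> i" "N \<le> j" for i j
    proof -
      have "norm (poly_op (p i - p j) A) \<le> e / 2"
        using N[OF _ that] by (intro norm_poly_op_psd_le[OF A]) (auto simp: dist_real_def intro: less_imp_le)
      then show ?thesis
        using \<open>0 < e\<close> by (simp add: dist_norm poly_op_diff)
    qed
    then show "\<exists>N. \<forall>i\<ge>N. \<forall>j\<ge>N. dist (poly_op (p i) A) (poly_op (p j) A) < e" by blast
  qed
  then obtain B where B: "(\<lambda>k. poly_op (p k) A) \<longlonglongrightarrow> B"
    using Cauchy_convergent convergent_def by blast
  have "uniform_limit (real_spectrum A) (\<lambda>k. poly (p k)) f sequentially"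
    using real_spectrum_psd[OF A(1)] A(2) by (intro uniform_limit_on_subset[OF p]) fastforce
  with B show ?thesis
    using cfc_eqI[OF H] by blast
qed

lemma poly_limit_cfc:
  assumes "psd A" "continuous_on {0..norm A} f"
  obtains p where "uniform_limit {0..norm A} (\<lambda>k. poly (p k)) f sequentially"
    and "(\<lambda>k. poly_op (p k) A) \<longlonglongrightarrow> cfc f A"
  using Weierstrass_uniform_limit[OF assms(2)] cfc_limit[OF assms(1) order_refl] by metis

lemma cfc_cong:
  assumes "psd A" "\<And>r. r \<in> {0..norm A} \<Longrightarrow> f r = g r"
  shows "cfc f A = cfc g A"
proof -
  have "uniform_limit (real_spectrum A) p f sequentially \<longleftrightarrow> uniform_limit (real_spectrum A) p g sequentially"
    for p :: "nat \<Rightarrow> real \<Rightarrow> real"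
    using real_spectrum_psd[OF assms(1)] assms(2) by (intro uniform_limit_cong') auto
  then show ?thesis
    by (simp add: cfc_def)
qed

lemma cfc_poly: "psd A \<Longrightarrow> cfc (poly p) A = poly_op p A"
  by (rule cfc_eqI[of _ "\<lambda>_. p"]) (auto simp: psd_def intro: uniform_limit_const)

lemma hermitian_cfc: "psd A \<Longrightarrow> continuous_on {0..norm A} f \<Longrightarrow> hermitian (cfc f A)"
  by (metis hermitian_limit hermitian_poly_op poly_limit_cfc psd_def)

lemma cfc_diff:
  assumes A: "psd A" and f: "continuous_on {0..norm A} f" and g: "continuous_on {0..norm A} g"
  shows "cfc (\<lambda>t. f t - g t) A = cfc f A - cfc g A"
proof -
  obtain p where p: "uniform_limit {0..norm A} (\<lambda>k. poly (p k)) f sequentially"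
    "(\<lambda>k. poly_op (p k) A) \<longlonglongrightarrow> cfc f A"
    using poly_limit_cfc[OF A f] .
  obtain q where q: "uniform_limit {0..norm A} (\<lambda>k. poly (q k)) g sequentially"
    "(\<lambda>k. poly_op (q k) A) \<longlonglongrightarrow> cfc g A"
    using poly_limit_cfc[OF A g] .
  have "uniform_limit {0..norm A} (\<lambda>k. poly (p k - q k)) (\<lambda>t. f t - g t) sequentially"
    using uniform_limit_minus[OF p(1) q(1)] by (simp add: poly_diff[abs_def])
  then have "(\<lambda>k. poly_op (p k - q k) A) \<longlonglongrightarrow> cfc (\<lambda>t. f t - g t) A"
    by (rule cfc_limit[OF A order_refl])
  moreover have "(\<lambda>k. poly_op (p k - q k) A) \<longlonglongrightarrow> cfc f A - cfc g A"
    unfolding poly_op_diff by (intro tendsto_diff p q)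
  ultimately show ?thesis
    by (rule LIMSEQ_unique)
qed

lemma cfc_mult:
  assumes A: "psd A" and f: "continuous_on {0..norm A} f" and g: "continuous_on {0..norm A} g"
  shows "cfc (\<lambda>t. f t * g t) A = cfc f A o\<^sub>L cfc g A"
proof -
  obtain p where p: "uniform_limit {0..norm A} (\<lambda>k. poly (p k)) f sequentially"
    "(\<lambda>k. poly_op (p k) A) \<longlonglongrightarrow> cfc f A"
    using poly_limit_cfc[OF A f] .
  obtain q where q: "uniform_limit {0..norm A} (\<lambda>k. poly (q k)) g sequentially"
    "(\<lambda>k. poly_op (q k) A) \<longlonglongrightarrow> cfc g A"
    using poly_limit_cfc[OF A g] .
  have "bounded (f ` {0..norm A})" "bounded (g ` {0..norm A})"
    using f g by (simp_all add: compact_continuous_image compact_imp_bounded)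
  then have "uniform_limit {0..norm A} (\<lambda>k. poly (p k * q k)) (\<lambda>t. f t * g t) sequentially"
    using uniform_lim_mult[OF p(1) q(1)] by (simp add: poly_mult[abs_def])
  then have "(\<lambda>k. poly_op (p k * q k) A) \<longlonglongrightarrow> cfc (\<lambda>t. f t * g t) A"
    by (rule cfc_limit[OF A order_refl])
  moreover have "(\<lambda>k. poly_op (p k * q k) A) \<longlonglongrightarrow> (cfc f A o\<^sub>L cfc g A)"
    unfolding poly_op_mult
    by (intro bounded_bilinear.tendsto[OF bounded_bilinear_blinfun_compose] p q)
  ultimately show ?thesis
    by (rule LIMSEQ_unique)
qed

lemma qform_cfc_square:
  assumes A: "psd A" and f: "continuous_on {0..norm A} f"
  shows "qform (cfc (\<lambda>t. (f t)\<^sup>2) A) x = (norm (cfc f A x))\<^sup>2"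
  using cfc_mult[OF A f f] norm_sq_hermitian[OF hermitian_cfc[OF A f]]
  by (simp add: power2_eq_square qform_def)

text \<open>A nonnegative function of \<open>A\<close> is the square of the hermitian operator \<open>\<surd>f(A)\<close>.\<close>

lemma psd_cfc:
  assumes A: "psd A" and f: "continuous_on {0..norm A} f" "\<And>t. t \<in> {0..norm A} \<Longrightarrow> 0 \<le> f t"
  shows "psd (cfc f A)"
proof -
  have "cfc f A = cfc (\<lambda>t. (sqrt (f t))\<^sup>2) A"
    using f(2) by (intro cfc_cong[OF A]) simp
  then have "0 \<le> qform (cfc f A) x" for x
    using qform_cfc_square[OF A continuous_on_real_sqrt[OF f(1)]] by simp
  then show ?thesis
    using hermitian_cfc[OF A f(1)] by (simp add: psd_def)
qed

lemma qform_cfc_mono: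
  assumes A: "psd A" and f: "continuous_on {0..norm A} f" and g: "continuous_on {0..norm A} g"
    and le: "\<And>t. t \<in> {0..norm A} \<Longrightarrow> f t \<le> g t"
  shows "qform (cfc f A) x \<le> qform (cfc g A) x"
proof -
  have "psd (cfc (\<lambda>t. g t - f t) A)"
    using le by (intro psd_cfc[OF A] continuous_on_diff f g) simp
  then show ?thesis
    by (simp add: cfc_diff[OF A g f] psd_def qform_simps)
qed

lemma norm_cfc_apply_mono:
  assumes A: "psd A" and f: "continuous_on {0..norm A} f" and g: "continuous_on {0..norm A} g"
    and le: "\<And>t. t \<in> {0..norm A} \<Longrightarrow> \<bar>f t\<bar> \<le> \<bar>g t\<bar>"
  shows "norm (cfc f A x) \<le> norm (cfc g A x)"
proof (rule power2_le_imp_le)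
  have "qform (cfc (\<lambda>t. (f t)\<^sup>2) A) x \<le> qform (cfc (\<lambda>t. (g t)\<^sup>2) A) x"
    using le by (intro qform_cfc_mono[OF A] continuous_intros f g) (simp add: abs_le_square_iff)
  then show "(norm (cfc f A x))\<^sup>2 \<le> (norm (cfc g A x))\<^sup>2"
    by (simp add: qform_cfc_square A f g)
qed simp

lemma cfc_const: "psd A \<Longrightarrow> cfc (\<lambda>_. c) A = c *\<^sub>R id_blinfun"
  using cfc_poly[of A "[:c:]"] by (simp add: poly_op_const poly_pCons[abs_def])

lemma cfc_ident: "psd A \<Longrightarrow> cfc (\<lambda>t. t) A = A"
  using cfc_poly[of A "[:0, 1:]"] by (simp add: poly_op_X poly_pCons[abs_def])

lemma norm_cfc_apply_le:
  assumes A: "psd A" and f: "continuous_on {0..norm A} f"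
    and le: "\<And>t. t \<in> {0..norm A} \<Longrightarrow> \<bar>f t\<bar> \<le> c"
  shows "norm (cfc f A x) \<le> c * norm x"
proof -
  have "0 \<le> c"
    using le[of 0] by simp
  have "norm (cfc f A x) \<le> norm (cfc (\<lambda>_. c) A x)"
    using le by (intro norm_cfc_apply_mono[OF A f]) fastforce+
  then show ?thesis
    using \<open>0 \<le> c\<close> by (simp add: cfc_const A scaleR_blinfun.rep_eq)
qed

text \<open>
  Polynomials intertwine, and on an interval that covers both spectra the same polynomials
  approximate \<open>f(A)\<close> and \<open>f(B)\<close>.
\<close>

lemma cfc_intertwine:
  assumes A: "psd A" and B: "psd B" and X: "X o\<^sub>L A = B o\<^sub>L X" and f: "continuous_on {0..} f"
  shows "X o\<^sub>L cfc f A = cfc f B o\<^sub>L X"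
proof -
  define M where "M = max (norm A) (norm B)"
  have "continuous_on {0..M} f"
    using f by (rule continuous_on_subset) auto
  then obtain p where p: "uniform_limit {0..M} (\<lambda>k. poly (p k)) f sequentially"
    using Weierstrass_uniform_limit by blast
  have "(\<lambda>k. X o\<^sub>L poly_op (p k) A) \<longlonglongrightarrow> (X o\<^sub>L cfc f A)"
    by (intro bounded_bilinear.tendsto[OF bounded_bilinear_blinfun_compose] tendsto_const
        cfc_limit[OF A _ p]) (simp add: M_def)
  moreover have "(\<lambda>k. X o\<^sub>L poly_op (p k) A) \<longlonglongrightarrow> (cfc f B o\<^sub>L X)"
    unfolding poly_op_intertwine[OF X]
    by (intro bounded_bilinear.tendsto[OF bounded_bilinear_blinfun_compose] tendsto_const
        cfc_limit[OF B _ p]) (simp add: M_def)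
  ultimately show ?thesis
    by (rule LIMSEQ_unique)
qed

lemma continuous_on_poly_op [continuous_intros]:
  "continuous_on S G \<Longrightarrow> continuous_on S (\<lambda>t. poly_op p (G t))"
  by (induction p) (auto simp: poly_op_pCons intro!: continuous_intros
      bounded_bilinear.continuous_on[OF bounded_bilinear_blinfun_compose])

text \<open>Polynomials in \<open>G(t)\<close> are continuous in \<open>t\<close> and approximate \<open>f(G(t))\<close> uniformly in \<open>t\<close>.\<close>

lemma continuous_on_cfc:
  assumes G: "continuous_on S G" "\<And>t. t \<in> S \<Longrightarrow> psd (G t)" "\<And>t. t \<in> S \<Longrightarrow> norm (G t) \<le> M"
    and f: "continuous_on {0..} f"
  shows "continuous_on S (\<lambda>t. cfc f (G t))"
proof -
  have fM: "continuous_on {0..M} f"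
    using f by (rule continuous_on_subset) auto
  then obtain p where p: "uniform_limit {0..M} (\<lambda>k. poly (p k)) f sequentially"
    using Weierstrass_uniform_limit by blast
  have "uniform_limit S (\<lambda>k t. poly_op (p k) (G t)) (\<lambda>t. cfc f (G t)) sequentially"
  proof (rule uniform_limitI)
    fix e :: real assume "0 < e"
    then have "\<forall>\<^sub>F k in sequentially. \<forall>r\<in>{0..M}. dist (poly (p k) r) (f r) < e / 2"
      by (intro uniform_limitD[OF p]) simp
    then show "\<forall>\<^sub>F k in sequentially. \<forall>t\<in>S. dist (poly_op (p k) (G t)) (cfc f (G t)) < e"
    proof eventually_elim
      case (elim k)
      show ?case
      proof
        fix t assume t: "t \<in> S"
        have sub: "{0..norm (G t)} \<subseteq> {0..M}"
          using G(3)[OF t] by auto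
        have f': "continuous_on {0..norm (G t)} f"
          using fM sub by (rule continuous_on_subset)
        have "poly_op (p k) (G t) - cfc f (G t) = cfc (\<lambda>r. poly (p k) r - f r) (G t)"
          using G(2)[OF t] by (simp add: cfc_diff cfc_poly f' continuous_intros)
        moreover have "norm \<dots> \<le> e / 2"
        proof (rule norm_blinfun_bound)
          show "norm (cfc (\<lambda>r. poly (p k) r - f r) (G t) x) \<le> e / 2 * norm x" for x
            using elim sub
            by (intro norm_cfc_apply_le G(2) t continuous_intros f')
              (force simp: dist_real_def intro: less_imp_le)
        qed (use \<open>0 < e\<close> in simp)
        ultimately show "dist (poly_op (p k) (G t)) (cfc f (G t)) < e"
          using \<open>0 < e\<close> by (simp add: dist_norm)
      qed
    qed
  qed
  then show ?thesis
    by (rule uniform_limit_theorem[rotated]) (auto intro!: always_eventually continuous_intros G(1))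
qed

section \<open>Operator powers and the mixed Schwarz inequality\<close>

text \<open>The scalar function behind the operator powers, with \<open>0\<^sup>0 = 1\<close>.\<close>

abbreviation real_power :: "real \<Rightarrow> real \<Rightarrow> real"
  where "real_power s r \<equiv> (if s = 0 then 1 else r powr s)"

lemma continuous_on_real_power: "0 \<le> s \<Longrightarrow> continuous_on {0..} (real_power s)"
  by (cases "s = 0") (auto intro!: continuous_intros continuous_on_powr')

lemma continuous_on_real_power_Icc: "0 \<le> s \<Longrightarrow> continuous_on {0..M} (real_power s)"
  by (rule continuous_on_subset[OF continuous_on_real_power]) auto

lemma real_power_add: "0 \<le> r \<Longrightarrow> 0 \<le> s \<Longrightarrow> 0 \<le> t \<Longrightarrow> real_power s r * real_power t r = real_power (s + t) r"
  by (auto simp: powr_add)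

lemma real_power_le: "0 \<le> r \<Longrightarrow> 0 \<le> s \<Longrightarrow> s \<le> 1 \<Longrightarrow> real_power s r \<le> 1 + r"
proof (cases "r \<le> 1")
  case True
  then show "0 \<le> r \<Longrightarrow> 0 \<le> s \<Longrightarrow> s \<le> 1 \<Longrightarrow> ?thesis"
    using powr_le1[of s r] by auto
next
  case False
  then show "0 \<le> r \<Longrightarrow> 0 \<le> s \<Longrightarrow> s \<le> 1 \<Longrightarrow> ?thesis"
    using powr_mono[of s 1 r] by auto
qed

lemma psd_op_powr:
  assumes A: "psd A" and "0 \<le> s"
  shows "psd (op_powr A s)"
  unfolding op_powr_def
  by (rule psd_cfc[OF A continuous_on_real_power_Icc[OF \<open>0 \<le> s\<close>]]) simp

lemma qform_op_powr:
  assumes A: "psd A" and "0 \<le> s"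
  shows "qform (op_powr A (2 * s)) x = (norm (op_powr A s x))\<^sup>2"
proof -
  have "op_powr A (2 * s) = cfc (\<lambda>r. (real_power s r)\<^sup>2) A"
    unfolding op_powr_def using \<open>0 \<le> s\<close>
    by (intro cfc_cong[OF A]) (auto simp: power2_eq_square powr_add[symmetric])
  then show ?thesis
    using qform_cfc_square[OF A continuous_on_real_power_Icc[OF \<open>0 \<le> s\<close>]]
    by (simp add: op_powr_def)
qed

lemma op_abs:
  assumes T: "T \<in> bounded_ops"
  shows psd_op_abs: "psd (op_abs T)"
    and norm_op_abs_apply: "norm (op_abs T x) = norm (T x)"
proof -
  note TT = psd_adj_compose(1)[OF T]
  show "psd (op_abs T)"
    unfolding op_abs_def by (intro psd_op_powr TT) simp
  have "op_powr (adj T o\<^sub>L T) (2 * (1 / 2)) = cfc (\<lambda>t. t) (adj T o\<^sub>L T)"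
    unfolding op_powr_def by (rule cfc_cong[OF TT]) simp
  also have "\<dots> = adj T o\<^sub>L T"
    by (rule cfc_ident[OF TT])
  finally have "op_powr (adj T o\<^sub>L T) (2 * (1 / 2)) = adj T o\<^sub>L T" .
  then have "(norm (op_abs T x))\<^sup>2 = (norm (T x))\<^sup>2"
    using qform_op_powr[OF TT, of "1/2" x] psd_adj_compose(2)[OF T, of x]
    by (simp add: op_abs_def)
  then show "norm (op_abs T x) = norm (T x)"
    by (simp add: power2_eq_iff_nonneg)
qed

text \<open>
  Heuristically \<open>\<langle>Tx, y\<rangle> = \<langle>V|T|\<^sup>\<alpha>x, |T\<^sup>*|\<^sup>1\<^sup>-\<^sup>\<alpha>y\<rangle>\<close> with the partial isometry \<open>V\<close> of the polar
  decomposition. To avoid constructing \<open>V\<close>, the operator \<open>|T|\<^sup>-\<^sup>\<alpha>\<close> is replaced by the bounded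
  \<open>(|T|\<^sup>\<alpha> + \<epsilon>)\<^sup>-\<^sup>1\<close>, which \<open>T\<^sup>*\<close> intertwines with \<open>(|T\<^sup>*|\<^sup>\<alpha> + \<epsilon>)\<^sup>-\<^sup>1\<close>; the error that this
  introduces is at most a multiple of \<open>\<epsilon>\<close>.
\<close>

lemma mixed_Schwarz:
  assumes T: "T \<in> bounded_ops" and \<alpha>: "0 \<le> \<alpha>" "\<alpha> \<le> 1"
  shows "cmod (cinner (T x) y)
    \<le> norm (op_powr (op_abs T) \<alpha> x) * norm (op_powr (op_abs (adj T)) (1 - \<alpha>) y)"
proof -
  define P where "P = op_abs T"
  define Q where "Q = op_abs (adj T)"
  note T' = adj_bounded_ops[OF T]
  have P: "psd P" "\<And>z. norm (P z) = norm (T z)"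
    using op_abs[OF T] by (auto simp: P_def)
  have Q: "psd Q" "\<And>z. norm (Q z) = norm (adj T z)"
    using op_abs[OF T'] by (auto simp: Q_def)
  have PQ: "adj T o\<^sub>L Q = P o\<^sub>L adj T"
    unfolding P_def Q_def op_abs_def op_powr_def
  proof (rule cfc_intertwine)
    show "psd (adj (adj T) o\<^sub>L adj T)" "psd (adj T o\<^sub>L T)"
      using psd_adj_compose(1) T T' by auto
    show "adj T o\<^sub>L (adj (adj T) o\<^sub>L adj T) = adj T o\<^sub>L T o\<^sub>L adj T"
      by (simp add: adj_adj[OF T] blinfun_compose_assoc)
    show "continuous_on {0..} (real_power (1 / 2))"
      by (rule continuous_on_real_power) simp
  qed
  define a where "a = real_power \<alpha>"
  define b where "b = real_power (1 - \<alpha>)"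
  have a: "continuous_on {0..} a" and b: "continuous_on {0..} b"
    unfolding a_def b_def using \<alpha> by (intro continuous_on_real_power; simp)+
  have a_nonneg: "0 \<le> a t" for t
    by (simp add: a_def)
  have b_nonneg: "0 \<le> b t" for t
    by (simp add: b_def)
  have ab: "a t * b t = t" if "0 \<le> t" for t
    using real_power_add[of t \<alpha> "1 - \<alpha>"] that \<alpha> by (simp add: a_def b_def)
  define C where "C = (1 + norm P) * norm x * norm y"
  have eps: "cmod (cinner (T x) y) \<le> norm (cfc a P x) * norm (cfc b Q y) + e * C" if "0 < e" for e
  proof -
    define r where "r t = 1 / (a t + e)" for t
    have pos: "0 < a t + e" for t
      using a_nonneg[of t] \<open>0 < e\<close> by simp
    have r: "continuous_on {0..} r"
      unfolding r_def using pos by (intro continuous_intros a) (auto simp: less_imp_neq[symmetric])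
    have ar: "a t * r t \<le> 1" "0 \<le> a t * r t" "0 \<le> r t" "1 - a t * r t = e * r t" for t
      using pos[of t] a_nonneg[of t] \<open>0 < e\<close> by (auto simp: r_def field_simps)
    note on_P = continuous_on_subset[where s = "{0..}" and t = "{0..norm P}"]
    note on_Q = continuous_on_subset[where s = "{0..}" and t = "{0..norm Q}"]
    have "cfc (\<lambda>t. 1 - r t * a t) P = cfc (\<lambda>_. 1) P - cfc (\<lambda>t. r t * a t) P"
      by (intro cfc_diff P continuous_intros on_P[OF r] on_P[OF a]) auto
    also have "cfc (\<lambda>t. r t * a t) P = cfc r P o\<^sub>L cfc a P"
      by (intro cfc_mult P on_P[OF r] on_P[OF a]) auto
    finally have split: "x = cfc (\<lambda>t. 1 - r t * a t) P x + cfc r P (cfc a P x)"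
      by (simp add: cfc_const P(1) minus_blinfun.rep_eq)
    have small: "norm (T (cfc (\<lambda>t. 1 - r t * a t) P x)) \<le> e * (1 + norm P) * norm x"
    proof -
      have "cfc (\<lambda>t. t * (1 - r t * a t)) P = cfc (\<lambda>t. t) P o\<^sub>L cfc (\<lambda>t. 1 - r t * a t) P"
        by (intro cfc_mult P continuous_intros on_P[OF r] on_P[OF a]) auto
      then have "norm (T (cfc (\<lambda>t. 1 - r t * a t) P x)) = norm (cfc (\<lambda>t. t * (1 - r t * a t)) P x)"
        by (simp add: cfc_ident P)
      also have "\<dots> \<le> e * (1 + norm P) * norm x"
      proof (intro norm_cfc_apply_le P continuous_intros on_P[OF r] on_P[OF a])
        fix t assume t: "t \<in> {0..norm P}"
        (* t = b t * a t, and the error factor 1 - r a equals e r *)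
        have "t * (1 - r t * a t) = e * (b t * (a t * r t))"
          using ab[of t] ar(4)[of t] t by (simp add: mult.commute mult.left_commute)
        also have "\<dots> \<le> e * (b t * 1)"
          using ar b_nonneg \<open>0 < e\<close> by (intro mult_left_mono) auto
        also have "b t \<le> 1 + norm P"
          using real_power_le[of t "1 - \<alpha>"] t \<alpha> by (simp add: b_def)
        finally have "t * (1 - r t * a t) \<le> e * (1 + norm P)"
          using \<open>0 < e\<close> by simp
        moreover have "0 \<le> t * (1 - r t * a t)"
          using ar(1)[of t] t by (simp add: mult.commute)
        ultimately show "\<bar>t * (1 - r t * a t)\<bar> \<le> e * (1 + norm P)"
          by simp
      qed auto
      finally show ?thesis .
    qed
    (* moving r across T turns it into r(Q), where it cancels the factor |T*|^alpha of |T*| *)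
    have main: "cmod (cinner (T (cfc r P (cfc a P x))) y) \<le> norm (cfc a P x) * norm (cfc b Q y)"
    proof -
      have "hermitian (cfc r P)"
        by (intro hermitian_cfc P on_P[OF r]) auto
      then have "cinner (T (cfc r P (cfc a P x))) y = cinner (cfc a P x) (cfc r P (adj T y))"
        by (simp add: cinner_adj_right[OF T, symmetric] hermitianD)
      also have "cfc r P (adj T y) = adj T (cfc r Q y)"
        using cfc_intertwine[OF Q(1) P(1) PQ r] by (metis blinfun_apply_blinfun_compose)
      finally have "cmod (cinner (T (cfc r P (cfc a P x))) y)
          \<le> norm (cfc a P x) * norm (adj T (cfc r Q y))"
        by (simp add: cinner_Cauchy_Schwarz)
      also have "norm (adj T (cfc r Q y)) = norm (cfc (\<lambda>t. t * r t) Q y)"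
        using cfc_mult[OF Q(1) continuous_on_id on_Q[OF r]] by (simp add: cfc_ident Q)
      also have "\<dots> \<le> norm (cfc b Q y)"
      proof (intro norm_cfc_apply_mono Q continuous_intros on_Q[OF r] on_Q[OF b])
        fix t assume t: "t \<in> {0..norm Q}"
        have "\<bar>t * r t\<bar> = b t * (a t * r t)"
          using ab[of t] ar(3)[of t] t by (simp add: mult.commute mult.left_commute)
        also have "\<dots> \<le> b t"
          using ar(1)[of t] b_nonneg[of t] by (simp add: mult_left_le)
        finally show "\<bar>t * r t\<bar> \<le> \<bar>b t\<bar>" by simp
      qed auto
      finally show ?thesis
        by (simp add: mult_left_mono)
    qed
    have "cmod (cinner (T x) y) \<le> cmod (cinner (T (cfc (\<lambda>t. 1 - r t * a t) P x)) y)
        + cmod (cinner (T (cfc r P (cfc a P x))) y)"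
      by (subst split) (simp add: blinfun.add_right cinner_simps norm_triangle_ineq)
    also have "cmod (cinner (T (cfc (\<lambda>t. 1 - r t * a t) P x)) y) \<le> e * (1 + norm P) * norm x * norm y"
      by (rule order_trans[OF cinner_Cauchy_Schwarz mult_right_mono[OF small]]) simp
    finally show ?thesis
      using main by (simp add: C_def mult.assoc)
  qed
  have "cmod (cinner (T x) y) \<le> norm (cfc a P x) * norm (cfc b Q y)"
  proof (rule field_le_epsilon)
    fix d :: real assume "0 < d"
    have "0 \<le> C" by (simp add: C_def)
    then have "d / (C + 1) * C \<le> d"
      using \<open>0 < d\<close> by (simp add: field_simps)
    then show "cmod (cinner (T x) y) \<le> norm (cfc a P x) * norm (cfc b Q y) + d"
      using eps[of "d / (C + 1)"] \<open>0 < d\<close> \<open>0 \<le> C\<close> by simp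
  qed
  then show ?thesis
    by (simp add: op_powr_def P_def Q_def a_def b_def)
qed

section \<open>Convexity\<close>

lemma cfc_scaleR_id:
  assumes "0 \<le> r"
  shows "cfc f (r *\<^sub>R id_blinfun :: 'a::chilbert_space \<Rightarrow>\<^sub>L 'a) = f r *\<^sub>R id_blinfun"
proof -
  let ?A = "r *\<^sub>R id_blinfun :: 'a \<Rightarrow>\<^sub>L 'a"
  have H: "hermitian ?A"
    by (simp add: hermitian_scaleR)
  have spec: "s = r" if "complex_of_real s \<in> spectrum ?A" for s
    using real_spectrum_bounds[OF H, of s r r] that by (simp add: qform_simps)
  show ?thesis
  proof (rule cfc_eqI[OF H])
    show "uniform_limit (real_spectrum ?A) (\<lambda>_. poly [:f r:]) f sequentially"
      by (rule uniform_limitI) (auto dest!: spec)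
    show "(\<lambda>_. poly_op [:f r:] ?A) \<longlonglongrightarrow> f r *\<^sub>R id_blinfun"
      by (simp add: poly_op_const)
  qed
qed

lemma operator_convexD:
  fixes A B :: "'a::chilbert_space \<Rightarrow>\<^sub>L 'a"
  assumes f: "operator_convex TYPE('a) f" and "psd A" "psd B" "0 \<le> t" "t \<le> 1"
  shows "qform (cfc f ((1 - t) *\<^sub>R A + t *\<^sub>R B)) x
    \<le> (1 - t) * qform (cfc f A) x + t * qform (cfc f B) x"
proof -
  have "positive_op A" "positive_op B"
    using assms psd_iff_positive_op by (auto simp: psd_def)
  then have "positive_op ((1 - t) *\<^sub>R cfc f A + t *\<^sub>R cfc f B - cfc f ((1 - t) *\<^sub>R A + t *\<^sub>R B))"
    using f assms(4,5) by (simp add: operator_convex_def op_le_def)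
  then have "0 \<le> qform ((1 - t) *\<^sub>R cfc f A + t *\<^sub>R cfc f B - cfc f ((1 - t) *\<^sub>R A + t *\<^sub>R B)) x"
    by (simp add: positive_op_def qform_def)
  then show ?thesis
    by (simp add: qform_simps)
qed

text \<open>Operator convexity is tested on multiples of the identity, which exist as soon as the space is nonzero.\<close>

lemma operator_convex_imp_convex_on:
  fixes x :: "'a::chilbert_space"
  assumes f: "operator_convex TYPE('a) f" and "x \<noteq> 0"
  shows "convex_on {0..} f"
proof (rule convex_onI)
  fix t a b :: real
  assume t: "0 < t" "t < 1" and ab: "a \<in> {0..}" "b \<in> {0..}"
  let ?I = "id_blinfun :: 'a \<Rightarrow>\<^sub>L 'a"
  have "0 \<le> (1 - t) * a + t * b"
    using t ab by simp
  then have "cfc f ((1 - t) *\<^sub>R (a *\<^sub>R ?I) + t *\<^sub>R (b *\<^sub>R ?I)) = f ((1 - t) * a + t * b) *\<^sub>R ?I"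
    using cfc_scaleR_id[of "(1 - t) * a + t * b" f] by (simp add: scaleR_add_left)
  moreover have "psd (a *\<^sub>R ?I)" "psd (b *\<^sub>R ?I)"
    using ab by (simp_all add: psd_scaleR)
  ultimately have "f ((1 - t) * a + t * b) * (norm x)\<^sup>2
      \<le> ((1 - t) * f a + t * f b) * (norm x)\<^sup>2"
    using operator_convexD[OF f, of "a *\<^sub>R ?I" "b *\<^sub>R ?I" t x] t ab
    by (simp add: cfc_scaleR_id qform_simps algebra_simps)
  then show "f ((1 - t) *\<^sub>R a + t *\<^sub>R b) \<le> (1 - t) * f a + t * f b"
    using \<open>x \<noteq> 0\<close> by (simp add: mult_le_cancel_right)
qed simp

text \<open>At the endpoint \<open>f\<close> is squeezed between \<open>0\<close> and its chord over \<open>[0, 1]\<close>.\<close>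

lemma convex_nonneg_zero_continuous:
  fixes f :: "real \<Rightarrow> real"
  assumes f: "convex_on {0..} f" "\<And>x. 0 \<le> x \<Longrightarrow> 0 \<le> f x" "f 0 = 0"
  shows "continuous_on {0..} f"
  unfolding continuous_on_eq_continuous_within
proof
  fix x :: real assume "x \<in> {0..}"
  then consider "x = 0" | "0 < x" by fastforce
  then show "continuous (at x within {0..}) f"
  proof cases
    case 1
    have le: "f t \<le> t * f 1" if "0 \<le> t" "t \<le> 1" for t
      using convex_onD[OF f(1), of t 0 1] that f(3) by simp
    have "(f \<longlongrightarrow> 0) (at 0 within {0..})"
    proof (rule tendsto_sandwich)
      show "\<forall>\<^sub>F t in at 0 within {0..}. 0 \<le> f t"
        using f(2) by (auto simp: eventually_at_filter)
      show "\<forall>\<^sub>F t in at 0 within {0..}. f t \<le> t * f 1"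
        using le by (auto simp: eventually_at intro!: exI[of _ 1])
      show "((\<lambda>t. t * f 1) \<longlongrightarrow> 0) (at 0 within {0..})"
        by (auto intro!: tendsto_eq_intros)
    qed simp
    then show ?thesis
      using 1 f(3) by (simp add: continuous_within)
  next
    case 2
    have "continuous_on {0<..} f"
      using f(1) by (intro convex_on_continuous) (auto intro: convex_on_subset)
    then have "continuous (at x) f"
      using 2 by (simp add: continuous_on_eq_continuous_at)
    then show ?thesis
      by (rule continuous_at_imp_continuous_at_within)
  qed
qed

lemma convex_strict_mono_image:
  fixes f :: "real \<Rightarrow> real"
  assumes f: "convex_on {0..} f" "\<And>x. 0 \<le> x \<Longrightarrow> 0 \<le> f x" "f 0 = 0"
    and mono: "strict_mono_on {0..} f"
  shows "{0..} \<subseteq> f ` {0..}"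
proof
  fix y :: real assume "y \<in> {0..}"
  have f1: "0 < f 1"
    using strict_mono_onD[OF mono, of 0 1] f(3) by simp
  define b where "b = max 1 (y / f 1)"
  have "1 \<le> b" by (simp add: b_def)
  (* the graph lies above the ray from the origin through (1, f 1) *)
  have "f 1 \<le> (1 / b) * f b"
    using convex_onD[OF f(1), of "1 / b" 0 b] \<open>1 \<le> b\<close> f(3) by simp
  then have "b * f 1 \<le> f b"
    using \<open>1 \<le> b\<close> by (simp add: field_simps)
  moreover have "y \<le> b * f 1"
    using f1 by (simp add: b_def max_def field_simps)
  ultimately have "y \<le> f b" by simp
  moreover have "continuous_on {0..b} f"
    by (rule continuous_on_subset[OF convex_nonneg_zero_continuous[OF f]]) auto
  ultimately obtain x where "0 \<le> x" "x \<le> b" "f x = y"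
    using IVT'[of f 0 y b] f(3) \<open>y \<in> {0..}\<close> \<open>1 \<le> b\<close> by auto
  then show "y \<in> f ` {0..}" by auto
qed

lemma finv_mono:
  assumes f: "strict_mono_on {0..} f" and "{0..} \<subseteq> f ` {0..}" and "0 \<le> y" "y \<le> z"
  shows "finv f y \<le> finv f z"
proof (rule ccontr)
  assume less: "\<not> finv f y \<le> finv f z"
  have yz: "y \<in> f ` {0..}" "z \<in> f ` {0..}"
    using assms by auto
  then have "f (finv f z) < f (finv f y)"
    using less by (intro strict_mono_onD[OF f] inv_into_into) auto
  then show False
    using yz \<open>y \<le> z\<close> by (simp add: f_inv_into_f)
qed

lemma convex_on_support_line:
  fixes f :: "real \<Rightarrow> real"
  assumes "convex_on I f" "m \<in> interior I"
  shows "\<exists>s. \<forall>t\<in>I. f m + s * (t - m) \<le> f t"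
  using convex_le_Inf_differential[OF assms] by blast

text \<open>
  Jensen's inequality: apply a support line of \<open>f\<close> at \<open>\<langle>Ax, x\<rangle>\<close> to \<open>A\<close>. At the boundary point \<open>0\<close>
  the horizontal line serves.
\<close>

lemma cfc_Jensen:
  fixes A :: "'a::chilbert_space \<Rightarrow>\<^sub>L 'a"
  assumes f: "convex_on {0..} f" "\<And>x. 0 \<le> x \<Longrightarrow> 0 \<le> f x" "f 0 = 0"
    and A: "psd A" and x: "norm x = 1"
  shows "f (qform A x) \<le> qform (cfc f A) x"
proof -
  define m where "m = qform A x"
  have "0 \<le> m" using A by (simp add: m_def psd_def)
  have "\<exists>s. \<forall>t\<in>{0..}. f m + s * (t - m) \<le> f t"
  proof (cases "m = 0")
    case True
    then show ?thesis using f by (intro exI[of _ 0]) simp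
  next
    case False
    then have "m \<in> interior {0..}"
      using \<open>0 \<le> m\<close> by (simp add: interior_real_atLeast)
    then show ?thesis
      by (rule convex_on_support_line[OF f(1)])
  qed
  then obtain s where s: "\<And>t. 0 \<le> t \<Longrightarrow> f m + s * (t - m) \<le> f t" by auto
  have "poly_op [:f m - s * m, s:] A = (f m - s * m) *\<^sub>R id_blinfun + s *\<^sub>R A"
    by (rule blinfun_eqI)
      (simp add: poly_op_pCons plus_blinfun.rep_eq scaleR_blinfun.rep_eq blinfun.scaleR_right)
  then have "f m = qform (poly_op [:f m - s * m, s:] A) x"
    using x by (simp add: qform_simps m_def)
  also have "\<dots> = qform (cfc (poly [:f m - s * m, s:]) A) x"
    by (simp add: cfc_poly[OF A])
  also have "\<dots> \<le> qform (cfc f A) x"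
    using s by (intro qform_cfc_mono[OF A] continuous_intros
        continuous_on_subset[OF convex_nonneg_zero_continuous[OF f]]) (auto simp: algebra_simps)
  finally show ?thesis
    by (simp add: m_def)
qed

lemma has_integral_affine_midpoint:
  fixes a b c s :: real
  assumes "a \<le> b"
  shows "((\<lambda>t. c + s * (t - (a + b) / 2)) has_integral (b - a) * c) {a..b}"
proof -
  let ?F = "\<lambda>t. c * t + s * (t - (a + b) / 2)\<^sup>2 / 2"
  have "((\<lambda>t. c + s * (t - (a + b) / 2)) has_integral (?F b - ?F a)) {a..b}"
    by (rule fundamental_theorem_of_calculus[OF assms])
      (auto simp: has_real_derivative_iff_has_vector_derivative[symmetric]
        intro!: derivative_eq_intros)
  moreover have "?F b - ?F a = (b - a) * c"
    by (simp add: power2_eq_square field_simps)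
  ultimately show ?thesis by simp
qed

text \<open>The Hermite-Hadamard inequalities: compare with a support line at the midpoint and with the chord.\<close>

lemma Hermite_Hadamard:
  fixes \<phi> :: "real \<Rightarrow> real"
  assumes \<phi>: "convex_on {a..b} \<phi>" "continuous_on {a..b} \<phi>" and "a \<le> b"
  shows Hermite_Hadamard_lower: "(b - a) * \<phi> ((a + b) / 2) \<le> integral {a..b} \<phi>"
    and Hermite_Hadamard_upper: "integral {a..b} \<phi> \<le> (b - a) * ((\<phi> a + \<phi> b) / 2)"
proof -
  have int: "(\<phi> has_integral integral {a..b} \<phi>) {a..b}"
    using \<phi>(2) by (intro integrable_integral integrable_continuous_real)
  show "(b - a) * \<phi> ((a + b) / 2) \<le> integral {a..b} \<phi>"
  proof (cases "a = b")
    case False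
    then have "(a + b) / 2 \<in> interior {a..b}"
      using \<open>a \<le> b\<close> by simp
    then obtain s where "\<And>t. t \<in> {a..b} \<Longrightarrow> \<phi> ((a + b) / 2) + s * (t - (a + b) / 2) \<le> \<phi> t"
      using convex_on_support_line[OF \<phi>(1)] by blast
    then show ?thesis
      by (rule has_integral_le[OF has_integral_affine_midpoint[OF \<open>a \<le> b\<close>] int])
  qed simp
  show "integral {a..b} \<phi> \<le> (b - a) * ((\<phi> a + \<phi> b) / 2)"
  proof (cases "a = b")
    case False
    define s where "s = (\<phi> b - \<phi> a) / (b - a)"
    have "\<phi> t \<le> (\<phi> a + \<phi> b) / 2 + s * (t - (a + b) / 2)" if "t \<in> {a..b}" for t
    proof -
      have "\<phi> t \<le> s * (t - a) + \<phi> a"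
        using convex_onD_Icc'[OF \<phi>(1) that] by (simp add: s_def)
      also have "\<dots> = (\<phi> a + \<phi> b) / 2 + s * (t - (a + b) / 2)"
        using False by (simp add: s_def field_simps)
      finally show ?thesis .
    qed
    then show ?thesis
      by (rule has_integral_le[OF int has_integral_affine_midpoint[OF \<open>a \<le> b\<close>]])
  qed simp
qed

section \<open>Integrals of hermitian operators\<close>

lemma hermitian_integral:
  fixes g :: "real \<Rightarrow> 'a::chilbert_space \<Rightarrow>\<^sub>L 'a"
  assumes int: "g integrable_on S" and g: "\<And>t. t \<in> S \<Longrightarrow> hermitian (g t)"
  shows "hermitian (integral S g)"
proof -
  (* being hermitian means that certain bounded linear maps vanish *)
  have vanish: "L (integral S g) = 0"
    if "bounded_linear L" "\<And>A. hermitian A \<Longrightarrow> L A = 0" for L :: "('a \<Rightarrow>\<^sub>L 'a) \<Rightarrow> 'b::real_normed_vector"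
  proof -
    have "L (integral S g) = integral S (L \<circ> g)"
      using integral_linear[OF int \<open>bounded_linear L\<close>] by simp
    also have "\<dots> = integral S (\<lambda>_. 0)"
      using g that(2) by (intro integral_cong) simp
    finally show ?thesis by simp
  qed
  have scale: "bounded_linear (\<lambda>x::'a. c *\<^sub>C x)" for c
    by (rule bounded_linear_intro[where K = "cmod c"])
      (simp_all add: scaleC_add_right scaleC_scaleR_commute norm_scaleC)
  have "integral S g (c *\<^sub>C x) - c *\<^sub>C integral S g x = 0" for c x
    by (rule vanish)
      (auto intro!: bounded_linear_sub bounded_linear_compose[OF scale] blinfun.bounded_linear_left
        simp: hermitian_def bounded_ops_scaleC)
  moreover have "cinner (integral S g x) y - cinner x (integral S g y) = 0" for x y
    by (rule vanish)
      (auto intro!: bounded_linear_sub blinfun.bounded_linear_left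
        bounded_linear_compose[OF bounded_bilinear.bounded_linear_left[OF bounded_bilinear_cinner]]
        bounded_linear_compose[OF bounded_bilinear.bounded_linear_right[OF bounded_bilinear_cinner]]
        simp: hermitianD)
  ultimately show ?thesis
    by (simp add: hermitian_def bounded_ops_def)
qed

lemma qform_integral:
  fixes g :: "real \<Rightarrow> 'a::chilbert_space \<Rightarrow>\<^sub>L 'a"
  assumes "g integrable_on S"
  shows "qform (integral S g) x = integral S (\<lambda>t. qform (g t) x)"
proof -
  have "bounded_linear (\<lambda>A :: 'a \<Rightarrow>\<^sub>L 'a. qform A x)"
    unfolding qform_def
    by (intro bounded_linear_compose[OF bounded_linear_Re]
        bounded_linear_compose[OF bounded_bilinear.bounded_linear_left[OF bounded_bilinear_cinner]]
        blinfun.bounded_linear_left)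
  from integral_linear[OF assms this] show ?thesis
    by (simp add: o_def)
qed

section \<open>The refined bound for the operator radius\<close>

lemma mixed_Schwarz_mean:
  assumes T: "T \<in> bounded_ops" and \<alpha>: "0 \<le> \<alpha>" "\<alpha> \<le> 1"
  shows "cmod (cinner (T x) x)
    \<le> (qform (op_powr (op_abs T) (2 * \<alpha>)) x
      + qform (op_powr (op_abs (adj T)) (2 * (1 - \<alpha>))) x) / 2"
proof -
  define u where "u = norm (op_powr (op_abs T) \<alpha> x)"
  define v where "v = norm (op_powr (op_abs (adj T)) (1 - \<alpha>) x)"
  have "cmod (cinner (T x) x) \<le> u * v"
    unfolding u_def v_def by (rule mixed_Schwarz[OF assms])
  also have "\<dots> \<le> (u\<^sup>2 + v\<^sup>2) / 2"
    using sum_squares_bound[of u v] by simp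
  also have "u\<^sup>2 = qform (op_powr (op_abs T) (2 * \<alpha>)) x"
    unfolding u_def using \<alpha> by (simp only: qform_op_powr[OF psd_op_abs[OF T]])
  also have "v\<^sup>2 = qform (op_powr (op_abs (adj T)) (2 * (1 - \<alpha>))) x"
    unfolding v_def using \<alpha>
    by (intro qform_op_powr[OF psd_op_abs[OF adj_bounded_ops[OF T]], symmetric]) simp
  finally show ?thesis .
qed

theorem theorem3p1:
  fixes T :: "nat \<Rightarrow> 'a::chilbert_space \<Rightarrow>\<^sub>L 'a"
    and f :: "real \<Rightarrow> real"
    and n :: nat
    and \<alpha> l :: real
  assumes T: "\<And>j. j \<in> {1..n} \<Longrightarrow> T j \<in> bounded_ops"
    and f_nonneg: "\<And>x. x \<ge> 0 \<Longrightarrow> f x \<ge> 0"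
    and f_mono: "strict_mono_on {0..} f"
    and f_convex: "operator_convex TYPE('a) f"
    and f_zero: "f 0 = 0"
    and \<alpha>: "0 \<le> \<alpha>" "\<alpha> \<le> 1"
    and l: "0 \<le> l" "l \<le> 1"
  shows "omega f n T
      \<le> finv f (norm (\<Sum>j=1..n.
            (1 - l) *\<^sub>R cfc f ((1/2) *\<^sub>R ((1 - l) *\<^sub>R op_powr (op_abs (T j)) (2 * \<alpha>)
                                  + (1 + l) *\<^sub>R op_powr (op_abs (adj (T j))) (2 * (1 - \<alpha>))))
            + l *\<^sub>R cfc f ((1/2) *\<^sub>R ((2 - l) *\<^sub>R op_powr (op_abs (T j)) (2 * \<alpha>)
                                  + l *\<^sub>R op_powr (op_abs (adj (T j))) (2 * (1 - \<alpha>))))))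
    \<and> finv f (norm (\<Sum>j=1..n.
            (1 - l) *\<^sub>R cfc f ((1/2) *\<^sub>R ((1 - l) *\<^sub>R op_powr (op_abs (T j)) (2 * \<alpha>)
                                  + (1 + l) *\<^sub>R op_powr (op_abs (adj (T j))) (2 * (1 - \<alpha>))))
            + l *\<^sub>R cfc f ((1/2) *\<^sub>R ((2 - l) *\<^sub>R op_powr (op_abs (T j)) (2 * \<alpha>)
                                  + l *\<^sub>R op_powr (op_abs (adj (T j))) (2 * (1 - \<alpha>))))))
      \<le> finv f (norm (integral {0..1} (\<lambda>t::real. \<Sum>j=1..n.
            cfc f (t *\<^sub>R op_powr (op_abs (T j)) (2 * \<alpha>)
                   + (1 - t) *\<^sub>R op_powr (op_abs (adj (T j))) (2 * (1 - \<alpha>))))))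
    \<and> finv f (norm (integral {0..1} (\<lambda>t::real. \<Sum>j=1..n.
            cfc f (t *\<^sub>R op_powr (op_abs (T j)) (2 * \<alpha>)
                   + (1 - t) *\<^sub>R op_powr (op_abs (adj (T j))) (2 * (1 - \<alpha>))))))
      \<le> finv f ((1/2) * norm (\<Sum>j=1..n.
            cfc f (op_powr (op_abs (T j)) (2 * \<alpha>))
            + cfc f (op_powr (op_abs (adj (T j))) (2 * (1 - \<alpha>)))))"
proof (cases "\<exists>x::'a. x \<noteq> 0")
  case False
  (* on the zero space f need not be convex, but all three norms vanish *)
  then have zero: "x = 0" for x :: 'a
    by blast
  then have op_zero: "A = 0" for A :: "'a \<Rightarrow>\<^sub>L 'a"
    by (intro blinfun_eqI) metis
  have "0 \<in> f ` {0..}"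
    using f_zero by force
  moreover have "inj_on f {0..}"
    using f_mono by (rule strict_mono_on_imp_inj_on)
  ultimately have finv_0: "finv f 0 = 0"
    using f_zero by (metis atLeast_iff inv_into_f_f order_refl)
  have omega_0: "omega f n T = 0"
  proof -
    have "norm x \<noteq> 1" for x :: 'a
      using zero[of x] by simp
    then show ?thesis
      by (simp add: omega_def)
  qed
  have norm_0: "norm A = 0" for A :: "'a \<Rightarrow>\<^sub>L 'a"
    using op_zero[of A] by simp
  show ?thesis
    by (simp only: omega_0 norm_0 finv_0 mult_zero_right order_refl simp_thms)
next
  case True
  then have f_convex_on: "convex_on {0..} f"
    using operator_convex_imp_convex_on[OF f_convex] by blast
  note f = f_convex_on f_nonneg f_zero
  note f_cont = convex_nonneg_zero_continuous[OF f]
  note f_cont_Icc = continuous_on_subset[OF f_cont]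
  note finv_le = finv_mono[OF f_mono convex_strict_mono_image[OF f f_mono]]
  define A where "A j = op_powr (op_abs (T j)) (2 * \<alpha>)" for j
  define B where "B j = op_powr (op_abs (adj (T j))) (2 * (1 - \<alpha>))" for j
  define G where "G j t = t *\<^sub>R A j + (1 - t) *\<^sub>R B j" for j and t :: real
  define g where "g t = (\<Sum>j=1..n. cfc f (G j t))" for t
  define X where "X = (1 - l) *\<^sub>R g ((1 - l) / 2) + l *\<^sub>R g ((2 - l) / 2)"
  define Y where "Y = (1 / 2) *\<^sub>R (g 1 + g 0)"
  have psd_AB: "psd (A j)" "psd (B j)" if "j \<in> {1..n}" for j
    using T[OF that] \<alpha> unfolding A_def B_def
    by (auto intro!: psd_op_powr psd_op_abs adj_bounded_ops)
  have psd_G: "psd (G j t)" if "j \<in> {1..n}" "t \<in> {0..1}" for j t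
    unfolding G_def using that psd_AB by (intro psd_add psd_scaleR) auto
  have psd_fG: "psd (cfc f (G j t))" if "j \<in> {1..n}" "t \<in> {0..1}" for j t
    using f_nonneg by (intro psd_cfc psd_G that f_cont_Icc) auto
  have psd_g: "psd (g t)" if "t \<in> {0..1}" for t
    unfolding g_def using psd_fG that by (intro psd_sum) auto
  have fG_cont: "continuous_on {0..1} (\<lambda>t. cfc f (G j t))" if j: "j \<in> {1..n}" for j
  proof (rule continuous_on_cfc)
    show "continuous_on {0..1} (G j)"
      unfolding G_def by (intro continuous_intros)
    show "norm (G j t) \<le> norm (A j) + norm (B j)" if "t \<in> {0..1}" for t
    proof -
      have "norm (G j t) \<le> t * norm (A j) + (1 - t) * norm (B j)"
        unfolding G_def using that by (intro norm_triangle_le) simp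
      also have "\<dots> \<le> 1 * norm (A j) + 1 * norm (B j)"
        using that by (intro add_mono mult_right_mono) auto
      finally show ?thesis by simp
    qed
  qed (use psd_G j f_cont in auto)
  have g_cont: "continuous_on {0..1} g"
    unfolding g_def by (intro continuous_on_sum fG_cont)
  have g_int: "g integrable_on {0..1}"
    using g_cont by (rule integrable_continuous_real)
  have \<phi>_convex: "convex_on {0..1} (\<lambda>t. qform (g t) x)" for x
  proof (rule convex_onI)
    fix u s t :: real
    assume u: "0 < u" "u < 1" and st: "s \<in> {0..1}" "t \<in> {0..1}"
    have "qform (cfc f (G j ((1 - u) * s + u * t))) x
        \<le> (1 - u) * qform (cfc f (G j s)) x + u * qform (cfc f (G j t)) x" if "j \<in> {1..n}" for j
    proof -
      have "G j ((1 - u) * s + u * t) = (1 - u) *\<^sub>R G j s + u *\<^sub>R G j t"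
        by (simp add: G_def algebra_simps)
      then show ?thesis
        using operator_convexD[OF f_convex psd_G[OF that st(1)] psd_G[OF that st(2)], of u x] u
        by simp
    qed
    then have "(\<Sum>j=1..n. qform (cfc f (G j ((1 - u) * s + u * t))) x)
        \<le> (\<Sum>j=1..n. (1 - u) * qform (cfc f (G j s)) x + u * qform (cfc f (G j t)) x)"
      by (intro sum_mono)
    then show "qform (g ((1 - u) *\<^sub>R s + u *\<^sub>R t)) x \<le> (1 - u) * qform (g s) x + u * qform (g t) x"
      by (simp add: g_def qform_sum sum.distrib sum_distrib_left)
  qed simp
  have \<phi>_cont: "continuous_on {0..1} (\<lambda>t. qform (g t) x)" for x
    using g_cont unfolding continuous_on_def by (auto intro!: tendsto_qform)
  have \<phi>_int: "qform (integral {0..1} g) x = integral {0..1} (\<lambda>t. qform (g t) x)" for x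
    by (rule qform_integral[OF g_int])
  have XI: "qform X x \<le> qform (integral {0..1} g) x" for x
  proof -
    (* the two evaluation points are the midpoints of [0, 1 - l] and [1 - l, 1] *)
    let ?\<phi> = "\<lambda>t. qform (g t) x"
    have "((1 - l) - 0) * ?\<phi> ((0 + (1 - l)) / 2) \<le> integral {0..1 - l} ?\<phi>"
      using l by (intro Hermite_Hadamard_lower convex_on_subset[OF \<phi>_convex]
          continuous_on_subset[OF \<phi>_cont]) auto
    moreover have "(1 - (1 - l)) * ?\<phi> (((1 - l) + 1) / 2) \<le> integral {1 - l..1} ?\<phi>"
      using l by (intro Hermite_Hadamard_lower convex_on_subset[OF \<phi>_convex]
          continuous_on_subset[OF \<phi>_cont]) auto
    moreover have "integral {0..1 - l} ?\<phi> + integral {1 - l..1} ?\<phi> = integral {0..1} ?\<phi>"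
      using l by (intro Henstock_Kurzweil_Integration.integral_combine
          integrable_continuous_real \<phi>_cont) auto
    ultimately show ?thesis
      by (simp add: X_def qform_simps \<phi>_int)
  qed
  have IY: "qform (integral {0..1} g) x \<le> qform Y x" for x
    using Hermite_Hadamard_upper[OF \<phi>_convex \<phi>_cont]
    by (simp add: Y_def qform_simps \<phi>_int add.commute)
  have psd_X: "psd X"
    unfolding X_def using l by (intro psd_add psd_scaleR psd_g) auto
  have psd_I: "psd (integral {0..1} g)"
    using psd_g hermitian_integral[OF g_int] order_trans[OF _ XI] psd_X by (auto simp: psd_def)
  have radius: "omega f n T \<le> finv f (norm X)"
    unfolding omega_def
  proof (rule cSup_least)
    fix y
    assume "y \<in> insert 0 {finv f (\<Sum>i=1..n. f (cmod (cinner (blinfun_apply (T i) x) x))) | x. norm x = 1}"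
    then consider "y = 0"
      | x where "norm x = 1" "y = finv f (\<Sum>i=1..n. f (cmod (cinner (blinfun_apply (T i) x) x)))"
      by blast
    then show "y \<le> finv f (norm X)"
    proof cases
      case 1
      have "norm X \<in> f ` {0..}"
        using convex_strict_mono_image[OF f f_mono] by auto
      then show ?thesis
        using inv_into_into[of "norm X" f "{0..}"] 1 by simp
    next
      case (2 x)
      let ?s = "(1 - l) / 2" and ?t = "(2 - l) / 2"
      have st: "?s \<in> {0..1}" "?t \<in> {0..1}"
        using l by auto
      have "f (cmod (cinner (T j x) x))
          \<le> (1 - l) * qform (cfc f (G j ?s)) x + l * qform (cfc f (G j ?t)) x" if j: "j \<in> {1..n}" for j
      proof -
        let ?a = "qform (G j ?s) x" and ?b = "qform (G j ?t) x"
        have nonneg: "0 \<le> ?a" "0 \<le> ?b"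
          using psd_G[OF j] st by (simp_all add: psd_def)
        have "cmod (cinner (T j x) x) \<le> (qform (A j) x + qform (B j) x) / 2"
          unfolding A_def B_def using T[OF j] \<alpha> by (rule mixed_Schwarz_mean)
        (* (1 - l) ?s + l ?t = 1/2 *)
        also have "\<dots> = (1 - l) * ?a + l * ?b"
          by (simp add: G_def qform_simps field_simps)
        finally have "f (cmod (cinner (T j x) x)) \<le> f ((1 - l) * ?a + l * ?b)"
          using strict_mono_on_imp_mono_on[OF f_mono] nonneg l by (auto simp: mono_on_def)
        also have "\<dots> \<le> (1 - l) * f ?a + l * f ?b"
          using convex_onD[OF f_convex_on, of l ?a ?b] nonneg l by simp
        also have "\<dots> \<le> (1 - l) * qform (cfc f (G j ?s)) x + l * qform (cfc f (G j ?t)) x"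
          using l st j psd_G 2(1) by (intro add_mono mult_left_mono cfc_Jensen f) auto
        finally show ?thesis .
      qed
      then have "(\<Sum>j=1..n. f (cmod (cinner (T j x) x)))
          \<le> (\<Sum>j=1..n. (1 - l) * qform (cfc f (G j ?s)) x + l * qform (cfc f (G j ?t)) x)"
        by (intro sum_mono)
      also have "\<dots> = qform X x"
        by (simp add: X_def g_def qform_simps qform_sum sum.distrib sum_distrib_left)
      also have "\<dots> \<le> norm X"
        using qform_le_norm[of X x] 2(1) by simp
      finally show ?thesis
        unfolding 2(2) using f_nonneg by (intro finv_le sum_nonneg) auto
    qed
  qed simp
  have "(\<Sum>j=1..n.
      (1 - l) *\<^sub>R cfc f ((1/2) *\<^sub>R ((1 - l) *\<^sub>R A j + (1 + l) *\<^sub>R B j))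
      + l *\<^sub>R cfc f ((1/2) *\<^sub>R ((2 - l) *\<^sub>R A j + l *\<^sub>R B j))) = X"
  proof -
    have coeffs: "(1 - l) / 2 = (1/2) * (1 - l)" "1 - (1/2) * (1 - l) = (1/2) * (1 + l)"
      "(2 - l) / 2 = (1/2) * (2 - l)" "1 - (1/2) * (2 - l) = (1/2) * l"
      by (simp_all add: field_simps)
    have "(1/2) *\<^sub>R ((1 - l) *\<^sub>R A j + (1 + l) *\<^sub>R B j) = G j ((1 - l) / 2)"
      "(1/2) *\<^sub>R ((2 - l) *\<^sub>R A j + l *\<^sub>R B j) = G j ((2 - l) / 2)" for j
      by (simp_all only: G_def coeffs scaleR_add_right scaleR_scaleR)
    then show ?thesis
      by (simp add: X_def g_def sum.distrib scaleR_sum_right)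
  qed
  moreover have "integral {0..1} (\<lambda>t. \<Sum>j=1..n. cfc f (t *\<^sub>R A j + (1 - t) *\<^sub>R B j)) = integral {0..1} g"
    by (simp add: g_def[abs_def] G_def)
  moreover have "(1/2) * norm (\<Sum>j=1..n. cfc f (A j) + cfc f (B j)) = norm Y"
    by (simp add: Y_def g_def G_def sum.distrib)
  moreover have "finv f (norm X) \<le> finv f (norm (integral {0..1} g))"
    by (intro finv_le norm_mono_psd psd_X XI norm_ge_zero)
  moreover have "finv f (norm (integral {0..1} g)) \<le> finv f (norm Y)"
    by (intro finv_le norm_mono_psd psd_I IY norm_ge_zero)
  ultimately show ?thesis
    using radius by (simp only: A_def B_def)
qed

end
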